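(* Consider problem (P) and Algorithm 2 described in the context. Let $\{(x_1^k,\dots,x_N^k,\lambda^k)\}_{k\ge 0}$ be a sequence generated by Algorithm 2, and suppose the parameters satisfy $$\beta>\frac{6+18\sqrt3}{13}L,\qquad \gamma\in\left(\frac{12}{13\beta+\sqrt{13\beta^2-12\beta L-72L^2}},\ \frac{12}{13\beta-\sqrt{13\beta^2-12\beta L-72L^2}}\right),$$ and $H_i\succ\left(\frac{6L^2}{\beta}+L\right)I$ for $i=1,\dots,N-1$. Define $$\kappa_1:=\frac{3}{\beta^2}\left[\left(\beta-\tfrac1\gamma\right)^2+L^2\right],\quad \kappa_2:=\left(\left|\beta-\tfrac1\gamma\right|+L\right)^2,\quad \kappa_3:=\left(L+\beta\sqrt N\max_{1\le i\le N}\|A_i\|_2^2+\max_{1\le i\le N-1}\|H_i\|_2\right)^2,$$ $$\tau:=\min\left\{-\left[\tfrac{\beta+L}{2}-\tfrac1\gamma+\tfrac6\beta\left(\beta-\tfrac1\gamma\right)^2+\tfrac{3L^2}{\beta}\right],\ \min_{1\le i\le N-1}\left\{-\left(\tfrac{3L^2}{\beta}+\tfrac L2-\tfrac{\sigma_{\min}(H_i)}{2}\right)\right\}\right\},$$ where $\sigma_{\min}$ denotes the smallest singular value. For $\epsilon>0$ let $$K:=\left\lceil\frac{2\max\{\kappa_1,\kappa_2,\kappa_3\}}{\tau\epsilon^2}\left(\Psi_G(x_1^1,\dots,x_N^1,\lambda^1,x_N^0)-\sum_{i=1}^{N-1}r_i^*-f^*\right)\right\rceil$$ and $k^*:=\operatorname{argmin}_{2\le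 k\le K+1}\sum_{i=1}^N\left(\|x_i^k-x_i^{k+1}\|^2+\|x_i^{k-1}-x_i^k\|^2\right)$. Then $(x_1^{k^*+1},\dots,x_N^{k^*+1})$ with multiplier $\lambda^{k^*+1}$ is an $\epsilon$-stationary solution of (P).
   Context: Problem (P): minimize $f(x_1,\dots,x_N)+\sum_{i=1}^{N-1}r_i(x_i)$ subject to $\sum_{i=1}^N A_ix_i=b$ with $A_N=I$, $x_N\in\mathbb R^{n_N}$, and $x_i\in\mathcal M_i\cap X_i$ for $i=1,\dots,N-1$. Here $A_i\in\mathbb R^{m\times n_i}$, $b\in\mathbb R^m$, $n_N=m$; $f:\mathbb R^{n_1}\times\cdots\times\mathbb R^{n_N}\to\mathbb R$ is smooth (possibly nonconvex) with $L$-Lipschitz gradient, $L>0$; $\nabla_i f$ is the partial gradient in block $x_i$; $r_i:\mathbb R^{n_i}\to\mathbb R$ is convex and locally Lipschitz (possibly nonsmooth); $\mathcal M_i$ is a Riemannian submanifold embedded in $\mathbb R^{n_i}$ (with the Euclidean inner product as metric); $X_i\subset\mathbb R^{n_i}$ is closed and convex. Assume the following are finite: $r_i^*=\min_{x_i\in\mathcal M_i\cap X_i}r_i(x_i)$ and $f^*=\min\{f(x): x_i\in\mathcal M_i\cap X_i\ (i\le N-1),\ x_N\in\mathbb R^{n_N}\}$. Augmented Lagrangian: $\mathcal L_\beta(x_1,\dots,x_N,\lambda)=f(x_1,\dots,x_N)+\sum_{i=1}^{N-1}r_i(x_i)-\langle\sum_{i=1}^N A_ix_i-b,\lambda\rangle+\frac\beta2\|\sum_{i=1}^N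 A_ix_i-b\|^2$. Write $\|v\|_H^2=v^\top Hv$. Potential: $\Psi_G(x_1,\dots,x_N,\lambda,\bar x)=\mathcal L_\beta(x_1,\dots,x_N,\lambda)+\frac3\beta\left[(\beta-\frac1\gamma)^2+L^2\right]\|\bar x-x_N\|^2$. Linearized approximation: $\hat{\mathcal L}^i_\beta(x_i;\hat x_1,\dots,\hat x_N,\lambda)=f(\hat x)+\langle\nabla_if(\hat x),x_i-\hat x_i\rangle+r_i(x_i)-\langle\sum_{j\ne i}A_j\hat x_j+A_ix_i-b,\lambda\rangle+\frac\beta2\|\sum_{j\ne i}A_j\hat x_j+A_ix_i-b\|^2$. Algorithm 2: given $x_i^0\in\mathcal M_i\cap X_i$ ($i\le N-1$), $x_N^0\in\mathbb R^{n_N}$, $\lambda^0\in\mathbb R^m$, $\beta,\gamma>0$, symmetric $H_i\succ0$; for $k=0,1,\dots$: Step 1: for $i=1,\dots,N-1$ in order, $x_i^{k+1}$ is a global minimizer (assumed to exist and be computable) over $x_i\in\mathcal M_i\cap X_i$ of $\hat{\mathcal L}^i_\beta(x_i;x_1^{k+1},\dots,x_{i-1}^{k+1},x_i^k,\dots,x_N^k,\lambda^k)+\frac12\|x_i-x_i^k\|_{H_i}^2$. Step 2: $x_N^{k+1}=x_N^k-\gamma\nabla_N\mathcal L_\beta(x_1^{k+1},\dots,x_{N-1}^{k+1},x_N^k,\lambda^k)$. Step 3: $\lambda^{k+1}=\lambda^k-\beta(\sum_{i=1}^N A_ix_i^{k+1}-b)$. Cones: for $C\subset\mathbb R^n$ and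 $x\in C$, the tangent cone $T_C(x)$ is the set of $w$ such that for all sequences $x_j\to x$ in $C$ and $t_j\downarrow0$ there are $w_j\to w$ with $x_j+t_jw_j\in C$ for all $j$. For a closed subset $S$ of $\mathcal M$, $x\in S$ and a chart $(U,\psi)$ of $\mathcal M$ at $x$: $\mathcal T_S(x)=[\mathbf D\psi(x)]^{-1}[T_{\psi(S\cap U)}(\psi(x))]$ and $\mathcal N_S(x)=\{u\in\mathcal T_x\mathcal M:\langle u,v\rangle\le0\ \forall v\in\mathcal T_S(x)\}$, where $\mathcal T_x\mathcal M$ is the tangent space. $\epsilon$-stationary solution: $x^*$ (with multiplier $\lambda^*$) is $\epsilon$-stationary for (P) if $\|\nabla_Nf(x^* )-A_N^\top\lambda^*\|\le\epsilon$, $\|\sum_{i=1}^N A_ix_i^*-b\|\le\epsilon$, and for $i=1,\dots,N-1$ $$\operatorname{dist}\left(\operatorname{Proj}_{\mathcal T_{x_i^*}\mathcal M_i}\left(-\nabla_if(x^* )+A_i^\top\lambda^*-\partial r_i(x_i^* )\right),\ \mathcal N_{X_i\cap\mathcal M_i}(x_i^* )\right)\le\epsilon,$$ where $\operatorname{dist}(A,B)=\inf_{a\in A,b\in B}\|a-b\|$, $\partial r_i$ is the convex subdifferential and $\operatorname{Proj}$ is orthogonal projection. *)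

theory Defs
  imports "HOL-Analysis.Analysis"
begin

section \<open>Submanifolds of a Euclidean space and cones on them\<close>

text \<open>\<open>Ck_on F W n g\<close>: the map \<open>g\<close> is n times continuously differentiable on \<open>W\<close>, where
  \<open>W\<close> is relatively open in the linear subspace \<open>F\<close>. Only directions in \<open>F\<close> are
  differentiated; on \<open>F\<close> the derivative within \<open>W\<close> is unique.\<close>

primrec Ck_on :: "'a::euclidean_space set \<Rightarrow> 'a set \<Rightarrow> nat \<Rightarrow> ('a \<Rightarrow> 'a) \<Rightarrow> bool" where
  "Ck_on F W 0 g \<longleftrightarrow> continuous_on W g"
| "Ck_on F W (Suc n) g \<longleftrightarrow> g differentiable_on W \<and>
     (\<forall>v\<in>F. Ck_on F W n (\<lambda>z. frechet_derivative g (at z within W) v))"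

text \<open>The derivative at \<open>\<psi> p\<close> of the local parametrization inverse to the chart \<open>\<psi>\<close> on \<open>U\<close>;
  restricted to the model space it is the inverse of the differential of \<open>\<psi>\<close> at \<open>p\<close>, as a map
  from the tangent space at \<open>p\<close>.\<close>

definition chart_inv_deriv ::
  "'a::euclidean_space set \<Rightarrow> ('a \<Rightarrow> 'a) \<Rightarrow> 'a \<Rightarrow> 'a \<Rightarrow> 'a" where
  "chart_inv_deriv U \<psi> p = frechet_derivative (inv_into U \<psi>) (at (\<psi> p) within \<psi> ` U)"

text \<open>A smooth chart \<open>(U, \<psi>)\<close> of \<open>M\<close> at \<open>p\<close>. Since the dimension d of \<open>M\<close> is not a type, a
  d-dimensional linear subspace \<open>F\<close> of the ambient space plays the role of the model space
  \<open>\<real>\<^sup>d\<close>. The charts of an embedded submanifold are exactly the homeomorphisms from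
  relatively open subsets of \<open>M\<close> to open subsets of the model space whose inverse is a smooth
  immersion into the ambient space.\<close>

definition chart_at ::
  "'a::euclidean_space set \<Rightarrow> 'a \<Rightarrow> 'a set \<Rightarrow> 'a set \<Rightarrow> ('a \<Rightarrow> 'a) \<Rightarrow> bool" where
  "chart_at M p F U \<psi> \<longleftrightarrow>
     subspace F \<and> openin (top_of_set M) U \<and> p \<in> U \<and>
     openin (top_of_set F) (\<psi> ` U) \<and> homeomorphism U (\<psi> ` U) \<psi> (inv_into U \<psi>) \<and>
     (\<forall>n. Ck_on F (\<psi> ` U) n (inv_into U \<psi>)) \<and>
     (\<forall>q\<in>U. inj_on (chart_inv_deriv U \<psi> q) F)"

definition embedded_submanifold :: "'a::euclidean_space set \<Rightarrow> bool" where
  "embedded_submanifold M \<longleftrightarrow>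
     (\<exists>d. \<forall>p\<in>M. \<exists>F U \<psi>. chart_at M p F U \<psi> \<and> dim F = d)"

definition tangent_space :: "'a::euclidean_space set \<Rightarrow> 'a \<Rightarrow> 'a set" where
  "tangent_space M p = {v. \<exists>F U \<psi>. chart_at M p F U \<psi> \<and> v \<in> chart_inv_deriv U \<psi> p ` F}"

text \<open>The regular (Clarke) tangent cone of \<open>C\<close> at \<open>x \<in> C\<close>.\<close>

definition tangent_cone :: "'a::euclidean_space set \<Rightarrow> 'a \<Rightarrow> 'a set" where
  "tangent_cone C x = {w. \<forall>xs ts.
     (\<forall>j. xs j \<in> C) \<and> xs \<longlonglongrightarrow> x \<and> (\<forall>j::nat. (0::real) < ts j) \<and> ts \<longlonglongrightarrow> 0 \<longrightarrow>
     (\<exists>ws. ws \<longlonglongrightarrow> w \<and> (\<forall>j. xs j + ts j *\<^sub>R ws j \<in> C))}"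

text \<open>The tangent and normal cones of \<open>S \<subseteq> M\<close> at \<open>p\<close>, computed in the chart \<open>(U, \<psi>)\<close>.\<close>

definition mfd_tangent_cone ::
  "'a::euclidean_space set \<Rightarrow> ('a \<Rightarrow> 'a) \<Rightarrow> 'a set \<Rightarrow> 'a \<Rightarrow> 'a set" where
  "mfd_tangent_cone U \<psi> S p = chart_inv_deriv U \<psi> p ` tangent_cone (\<psi> ` (S \<inter> U)) (\<psi> p)"

definition mfd_normal_cone ::
  "'a::euclidean_space set \<Rightarrow> 'a set \<Rightarrow> ('a \<Rightarrow> 'a) \<Rightarrow> 'a set \<Rightarrow> 'a \<Rightarrow> 'a set" where
  "mfd_normal_cone M U \<psi> S p =
     {u \<in> tangent_space M p. \<forall>v\<in>mfd_tangent_cone U \<psi> S p. u \<bullet> v \<le> 0}"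

section \<open>Gradients, subdifferentials, distances, matrices\<close>

definition grad :: "('a::euclidean_space \<Rightarrow> real) \<Rightarrow> 'a \<Rightarrow> 'a" where
  "grad f x = (THE D. GDERIV f x :> D)"

definition subdifferential_on ::
  "'a::euclidean_space set \<Rightarrow> ('a \<Rightarrow> real) \<Rightarrow> 'a \<Rightarrow> 'a set" where
  "subdifferential_on E r x = {g \<in> E. \<forall>y\<in>E. r x + g \<bullet> (y - x) \<le> r y}"

text \<open>In contrast to \<open>setdist\<close>, the value is \<open>\<infinity>\<close> (not 0) if one of the sets is empty.\<close>

definition set_dist :: "'a::real_normed_vector set \<Rightarrow> 'a set \<Rightarrow> ereal" where
  "set_dist A B = (INF a\<in>A. INF b\<in>B. ereal (norm (a - b)))"

definition pos_def_on :: "(real^'n) set \<Rightarrow> real^'n^'n \<Rightarrow> bool" where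
  "pos_def_on E B \<longleftrightarrow> (\<forall>v\<in>E. v \<noteq> 0 \<longrightarrow> 0 < v \<bullet> (B *v v))"

definition spectral_norm :: "real^'n^'m \<Rightarrow> real" where
  "spectral_norm B = onorm (\<lambda>v. B *v v)"

definition sigma_min_on :: "(real^'n) set \<Rightarrow> real^'n^'n \<Rightarrow> real" where
  "sigma_min_on E B =
     Min {sqrt \<mu> | \<mu>. \<exists>v\<in>E. v \<noteq> 0 \<and> (transpose B ** B) *v v = \<mu> *\<^sub>R v}"

section \<open>The problem\<close>

text \<open>The number N of blocks and their dimensions are arbitrary, so the blocks are encoded by
  labelling coordinates. The vector \<open>(x\<^sub>1, \<dots>, x\<^sub>N)\<close> is one element of \<open>real^('d + 'm)\<close>: a
  coordinate \<open>Inl j\<close> belongs to block \<open>label P j \<in> {1..N-1}\<close>, and the coordinates \<open>Inr k\<close> form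
  the block N, of dimension \<open>n\<^sub>N = m = CARD('m)\<close>. The space of the i-th block, of dimension
  \<open>n\<^sub>i\<close>, is \<open>block_space P i\<close>, the vectors vanishing outside block i; \<open>reg P i\<close>,
  \<open>mfd P i\<close> and \<open>cset P i\<close> (that is, \<open>r\<^sub>i\<close>, \<open>M\<^sub>i\<close> and \<open>X\<^sub>i\<close>) only matter there. \<open>cmat P\<close> is the matrix
  \<open>[A\<^sub>1 | \<dots> | A\<^sub>N]\<close>, so that \<open>cmat P *v x\<close> is the sum of the \<open>A\<^sub>i x\<^sub>i\<close>.\<close>

record ('d::finite, 'm::finite) problem =
  nblocks :: nat
  label :: "'d \<Rightarrow> nat"
  obj :: "real^('d + 'm) \<Rightarrow> real"
  reg :: "nat \<Rightarrow> real^('d + 'm) \<Rightarrow> real"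
  mfd :: "nat \<Rightarrow> (real^('d + 'm)) set"
  cset :: "nat \<Rightarrow> (real^('d + 'm)) set"
  cmat :: "real^('d + 'm)^'m"
  rhs :: "real^'m"

definition block_of :: "('d::finite, 'm::finite) problem \<Rightarrow> 'd + 'm \<Rightarrow> nat" where
  "block_of P = case_sum (label P) (\<lambda>_. nblocks P)"

definition block_space :: "('d::finite, 'm::finite) problem \<Rightarrow> nat \<Rightarrow> (real^('d + 'm)) set" where
  "block_space P i = {x. \<forall>c. block_of P c \<noteq> i \<longrightarrow> x $ c = 0}"

definition block :: "('d::finite, 'm::finite) problem \<Rightarrow> nat \<Rightarrow> real^('d + 'm) \<Rightarrow> real^('d + 'm)" where
  "block P i x = (\<chi> c. if block_of P c = i then x $ c else 0)"

definition replace_block ::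
  "('d::finite, 'm::finite) problem \<Rightarrow> nat \<Rightarrow> real^('d + 'm) \<Rightarrow> real^('d + 'm) \<Rightarrow> real^('d + 'm)" where
  "replace_block P i x u = (\<chi> c. if block_of P c = i then u $ c else x $ c)"

definition col_block :: "('d::finite, 'm::finite) problem \<Rightarrow> nat \<Rightarrow> real^('d + 'm)^'m" where
  "col_block P i = (\<chi> r c. if block_of P c = i then cmat P $ r $ c else 0)"

text \<open>The partial gradient in block i: the gradient of \<open>F\<close> with all other blocks frozen at \<open>x\<close>.
  It lies in \<open>block_space P i\<close>.\<close>

definition partial_grad ::
  "('d::finite, 'm::finite) problem \<Rightarrow> nat \<Rightarrow> (real^('d + 'm) \<Rightarrow> real) \<Rightarrow> real^('d + 'm) \<Rightarrow> real^('d + 'm)" where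
  "partial_grad P i F x = grad (\<lambda>z. F (replace_block P i x z)) x"

definition feasible_block :: "('d::finite, 'm::finite) problem \<Rightarrow> nat \<Rightarrow> (real^('d + 'm)) set" where
  "feasible_block P i = mfd P i \<inter> cset P i"

definition obj_domain :: "('d::finite, 'm::finite) problem \<Rightarrow> (real^('d + 'm)) set" where
  "obj_domain P = {x. \<forall>i\<in>{1..<nblocks P}. block P i x \<in> feasible_block P i}"

definition reg_min :: "('d::finite, 'm::finite) problem \<Rightarrow> nat \<Rightarrow> real" where
  "reg_min P i = (INF u\<in>feasible_block P i. reg P i u)"

definition obj_min :: "('d::finite, 'm::finite) problem \<Rightarrow> real" where
  "obj_min P = (INF x\<in>obj_domain P. obj P x)"

text \<open>The standing assumptions on the data. Surjectivity of the labelling onto \<open>{1..N-1}\<close> says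
  that all blocks have positive dimension and gives \<open>N \<ge> 2\<close>.\<close>

definition admissible_problem :: "('d::finite, 'm::finite) problem \<Rightarrow> real \<Rightarrow> bool" where
  "admissible_problem P L \<longleftrightarrow>
     range (label P) = {1..<nblocks P} \<and>
     (\<forall>r s. cmat P $ r $ Inr s = (if r = s then 1 else 0)) \<and>
     0 < L \<and> (\<forall>x. obj P differentiable (at x)) \<and> L-lipschitz_on UNIV (grad (obj P)) \<and>
     (\<forall>i\<in>{1..<nblocks P}.
        convex_on (block_space P i) (reg P i) \<and>
        (\<forall>u\<in>block_space P i. \<exists>e>0. \<exists>C. C-lipschitz_on (cball u e \<inter> block_space P i) (reg P i)) \<and>
        mfd P i \<subseteq> block_space P i \<and> embedded_submanifold (mfd P i) \<and>
        cset P i \<subseteq> block_space P i \<and> closed (cset P i) \<and> convex (cset P i) \<and>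
        bdd_below (reg P i ` feasible_block P i)) \<and>
     bdd_below (obj P ` obj_domain P)"

section \<open>Augmented Lagrangian, algorithm and stationarity\<close>

definition residual :: "('d::finite, 'm::finite) problem \<Rightarrow> real^('d + 'm) \<Rightarrow> real^'m" where
  "residual P x = cmat P *v x - rhs P"

definition aug_lagrangian ::
  "('d::finite, 'm::finite) problem \<Rightarrow> real \<Rightarrow> real^('d + 'm) \<Rightarrow> real^'m \<Rightarrow> real" where
  "aug_lagrangian P \<beta> x l =
     obj P x + (\<Sum>i\<in>{1..<nblocks P}. reg P i (block P i x))
     - residual P x \<bullet> l + \<beta> / 2 * (norm (residual P x))\<^sup>2"

text \<open>The last argument is an element of \<open>block_space P (nblocks P)\<close>.\<close>

definition Psi_G ::
  "('d::finite, 'm::finite) problem \<Rightarrow> real \<Rightarrow> real \<Rightarrow> real \<Rightarrow> real^('d + 'm) \<Rightarrow> real^'m \<Rightarrow> real^('d + 'm) \<Rightarrow> real" where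
  "Psi_G P L \<beta> \<gamma> x l xbar =
     aug_lagrangian P \<beta> x l
     + 3 / \<beta> * ((\<beta> - 1 / \<gamma>)\<^sup>2 + L\<^sup>2) * (norm (xbar - block P (nblocks P) x))\<^sup>2"

definition lin_aug_lagrangian ::
  "('d::finite, 'm::finite) problem \<Rightarrow> real \<Rightarrow> nat \<Rightarrow> real^('d + 'm) \<Rightarrow> real^('d + 'm) \<Rightarrow> real^'m \<Rightarrow> real" where
  "lin_aug_lagrangian P \<beta> i u xh l =
     obj P xh + partial_grad P i (obj P) xh \<bullet> (u - block P i xh) + reg P i u
     - residual P (replace_block P i xh u) \<bullet> l
     + \<beta> / 2 * (norm (residual P (replace_block P i xh u)))\<^sup>2"

text \<open>The Gauss-Seidel point whose blocks before i are taken from \<open>xnew\<close>, the others from \<open>xold\<close>.\<close>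

definition mixed_point ::
  "('d::finite, 'm::finite) problem \<Rightarrow> nat \<Rightarrow> real^('d + 'm) \<Rightarrow> real^('d + 'm) \<Rightarrow> real^('d + 'm)" where
  "mixed_point P i xnew xold = (\<chi> c. if block_of P c < i then xnew $ c else xold $ c)"

text \<open>The square matrix \<open>H\<^sub>i\<close> on block i is padded with zeros to a matrix on the whole space.\<close>

definition block_matrix ::
  "('d::finite, 'm::finite) problem \<Rightarrow> nat \<Rightarrow> real^('d + 'm)^('d + 'm) \<Rightarrow> bool" where
  "block_matrix P i B \<longleftrightarrow> (\<forall>c c'. block_of P c \<noteq> i \<or> block_of P c' \<noteq> i \<longrightarrow> B $ c $ c' = 0)"

definition algorithm2 ::
  "('d::finite, 'm::finite) problem \<Rightarrow> real \<Rightarrow> real \<Rightarrow> (nat \<Rightarrow> real^('d + 'm)^('d + 'm)) \<Rightarrow>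
   (nat \<Rightarrow> real^('d + 'm)) \<Rightarrow> (nat \<Rightarrow> real^'m) \<Rightarrow> bool" where
  "algorithm2 P \<beta> \<gamma> H x l \<longleftrightarrow>
     0 < \<beta> \<and> 0 < \<gamma> \<and>
     (\<forall>i\<in>{1..<nblocks P}. block_matrix P i (H i) \<and> transpose (H i) = H i \<and>
        pos_def_on (block_space P i) (H i)) \<and>
     (\<forall>i\<in>{1..<nblocks P}. block P i (x 0) \<in> feasible_block P i) \<and>
     (\<forall>k. \<forall>i\<in>{1..<nblocks P}.
        is_arg_min
          (\<lambda>u. lin_aug_lagrangian P \<beta> i u (mixed_point P i (x (Suc k)) (x k)) (l k)
               + 1 / 2 * ((u - block P i (x k)) \<bullet> (H i *v (u - block P i (x k)))))
          (\<lambda>u. u \<in> feasible_block P i)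
          (block P i (x (Suc k)))) \<and>
     (\<forall>k. block P (nblocks P) (x (Suc k)) =
        block P (nblocks P) (x k)
        - \<gamma> *\<^sub>R partial_grad P (nblocks P) (\<lambda>z. aug_lagrangian P \<beta> z (l k))
                 (mixed_point P (nblocks P) (x (Suc k)) (x k))) \<and>
     (\<forall>k. l (Suc k) = l k - \<beta> *\<^sub>R residual P (x (Suc k)))"

text \<open>The cones do not depend on the chart; stationarity asks for the estimate in every chart
  at the point. Membership in \<open>M\<^sub>i \<inter> X\<^sub>i\<close>, without which the normal cone is not defined, is
  included. Orthogonal projection onto a linear subspace is \<open>closest_point\<close>.\<close>

definition eps_stationary ::
  "('d::finite, 'm::finite) problem \<Rightarrow> real \<Rightarrow> real^('d + 'm) \<Rightarrow> real^'m \<Rightarrow> bool" where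
  "eps_stationary P \<epsilon> x l \<longleftrightarrow>
     norm (partial_grad P (nblocks P) (obj P) x - transpose (col_block P (nblocks P)) *v l) \<le> \<epsilon> \<and>
     norm (residual P x) \<le> \<epsilon> \<and>
     (\<forall>i\<in>{1..<nblocks P}.
        block P i x \<in> feasible_block P i \<and>
        (\<forall>F U \<psi>. chart_at (mfd P i) (block P i x) F U \<psi> \<longrightarrow>
           set_dist
             (closest_point (tangent_space (mfd P i) (block P i x)) `
                {- partial_grad P i (obj P) x + transpose (col_block P i) *v l - g | g.
                   g \<in> subdifferential_on (block_space P i) (reg P i) (block P i x)})
             (mfd_normal_cone (mfd P i) U \<psi> (feasible_block P i) (block P i x))
           \<le> ereal \<epsilon>))"

end

theory Submission
  imports Defs
begin

text \<open>The multiplier change is a sum of three terms, so squaring it costs a factor 3 and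
  leaves squares of the last-block step at two consecutive indices. The older square cannot be
  absorbed by the current step, so the extra term of the potential pays for it in advance. Restoring
  that term at the new index doubles the coefficient of (\<beta> - 1/\<gamma>)^2 to 6/\<beta>, which
  gives the first entry of \<tau>, a quadratic in 1/\<gamma>. The multiplier identity holds only
  from index 1 on, since the initial multiplier is arbitrary. Hence the potential starts at the
  first iterate, decrease is known from the step leaving it, and the candidates start at 2. On a
  manifold block, minimality yields one inequality per tangent direction, and a priori each
  direction has its own subgradient. Exchanging the quantifiers needs a convex set of directions.
  The regular tangent cone is convex, whereas the cone of limits of difference quotients at the
  point alone need not be.\<close>

text \<open>
  The last block step and the multiplier update together give
  \<open>\<lambda>\<^sup>k\<^sup>+\<^sup>1 = \<nabla>\<^sub>N f(x\<^sub>1\<^sup>k\<^sup>+\<^sup>1, \<dots>, x\<^sub>N\<^sub>-\<^sub>1\<^sup>k\<^sup>+\<^sup>1, x\<^sub>N\<^sup>k) + (\<beta> - 1/\<gamma>) (x\<^sub>N\<^sup>k - x\<^sub>N\<^sup>k\<^sup>+\<^sup>1)\<close>,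
  so the change of the multiplier, and with it the residual, is controlled by two successive primal
  steps. Comparing the subproblem values at the new and the old iterate shows that the potential
  decreases by at least \<open>\<tau>\<close> times the squared primal step. The residual is a multiple of the
  multiplier change, so the multiplier term of the augmented Lagrangian telescopes up to
  nonnegative terms, and the decreasing potential cannot drop below \<open>f\<^sup>* + \<Sum> r\<^sub>i\<^sup>*\<close>. Hence the
  squared steps are summable, and among the first \<open>K\<close> candidates there are two successive steps so
  short that all stationarity measures are at most \<open>\<epsilon>\<close>. For the blocks on the manifolds,
  minimality in the subproblem makes the directional derivatives nonnegative on the regular tangent
  cone, which is convex, and a separation argument then yields a single subgradient for the whole
  cone.
\<close>

section \<open>Tangent spaces and tangent cones\<close>

text \<open>The directions may vary with \<open>j\<close>, because tangent vectors arise here only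
  as limits. Since \<open>ws\<close> is bounded, the remainder of the derivative is
  o(\<open>ts j\<close>) uniformly along the sequence.\<close>

lemma difference_quotient_tendsto:
  fixes f :: "'a::real_normed_vector \<Rightarrow> 'b::real_normed_vector"
  assumes f: "(f has_derivative D) (at a within S)"
    and ws: "ws \<longlonglongrightarrow> w" and ts: "ts \<longlonglongrightarrow> 0" "\<And>j. 0 < ts j"
    and S: "\<And>j. a + ts j *\<^sub>R ws j \<in> S"
  shows "(\<lambda>j. (f (a + ts j *\<^sub>R ws j) - f a) /\<^sub>R ts j) \<longlonglongrightarrow> D w"
proof -
  have D: "bounded_linear D"
    using f by (rule has_derivative_bounded_linear)
  obtain B where B: "B > 0" "\<And>j. norm (ws j) \<le> B"
    using convergent_imp_Bseq[OF convergentI[OF ws]] by (auto elim: BseqE)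
  have small: "(\<lambda>j. ts j *\<^sub>R ws j) \<longlonglongrightarrow> 0"
    using tendsto_scaleR[OF ts(1) ws] by simp
  have "(\<lambda>j. (f (a + ts j *\<^sub>R ws j) - f a) /\<^sub>R ts j - D (ws j)) \<longlonglongrightarrow> 0"
  proof (rule LIMSEQ_I)
    fix e :: real assume "0 < e"
    then have "0 < e / (2 * B)" using B by simp
    then obtain d where d: "d > 0"
      "\<And>y. y \<in> S \<Longrightarrow> norm (y - a) < d \<Longrightarrow> norm (f y - f a - D (y - a)) \<le> e / (2 * B) * norm (y - a)"
      using f unfolding has_derivative_within_alt by blast
    obtain n where n: "\<And>j. j \<ge> n \<Longrightarrow> norm (ts j *\<^sub>R ws j) < d"
      using LIMSEQ_D[OF small d(1)] by auto
    have "norm ((f (a + ts j *\<^sub>R ws j) - f a) /\<^sub>R ts j - D (ws j) - 0) < e" if "j \<ge> n" for j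
    proof -
      let ?y = "a + ts j *\<^sub>R ws j"
      have t: "ts j > 0" by (rule ts)
      have "(f ?y - f a) /\<^sub>R ts j - D (ws j) = (f ?y - f a - D (?y - a)) /\<^sub>R ts j"
        using t by (simp add: scaleR_diff_right linear_scale[OF bounded_linear.linear[OF D]])
      then have "norm ((f ?y - f a) /\<^sub>R ts j - D (ws j)) = norm (f ?y - f a - D (?y - a)) / ts j"
        using t by (simp add: divide_inverse mult.commute)
      also have "\<dots> \<le> (e / (2 * B) * norm (?y - a)) / ts j"
        using d(2)[OF S[of j]] n[OF that] t by (intro divide_right_mono) simp_all
      also have "\<dots> = e / (2 * B) * norm (ws j)"
        using t by simp
      also have "\<dots> \<le> e / (2 * B) * B"
        using B \<open>0 < e\<close> by (intro mult_left_mono) auto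
      also have "\<dots> < e" using B \<open>0 < e\<close> by simp
      finally show ?thesis by simp
    qed
    then show "\<exists>n. \<forall>j\<ge>n. norm ((f (a + ts j *\<^sub>R ws j) - f a) /\<^sub>R ts j - D (ws j) - 0) < e"
      by blast
  qed
  from tendsto_add[OF this bounded_linear.tendsto[OF D ws]] show ?thesis by simp
qed

lemma chart_inv_has_derivative:
  assumes "chart_at M p F U \<psi>"
  shows "(inv_into U \<psi> has_derivative chart_inv_deriv U \<psi> p) (at (\<psi> p) within \<psi> ` U)"
proof -
  have "Ck_on F (\<psi> ` U) (Suc 0) (inv_into U \<psi>)" "p \<in> U"
    using assms by (auto simp: chart_at_def simp del: Ck_on.simps)
  then have "inv_into U \<psi> differentiable (at (\<psi> p) within \<psi> ` U)"
    by (auto simp: differentiable_on_def)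
  then show ?thesis
    by (simp add: chart_inv_deriv_def frechet_derivative_works)
qed

lemma chart_inv_left:
  "chart_at M p F U \<psi> \<Longrightarrow> q \<in> U \<Longrightarrow> inv_into U \<psi> (\<psi> q) = q"
  by (auto simp: chart_at_def homeomorphism_def)

lemma chart_image_subset: "chart_at M p F U \<psi> \<Longrightarrow> \<psi> ` U \<subseteq> F"
  by (auto simp: chart_at_def dest: openin_imp_subset)

lemma chart_linear: "chart_at M p F U \<psi> \<Longrightarrow> linear (chart_inv_deriv U \<psi> p)"
  using chart_inv_has_derivative by (rule has_derivative_linear)

text \<open>As the right-hand side does not mention the chart, all charts define the same tangent space.\<close>

lemma chart_image_eq_sequential_tangents:
  assumes ch: "chart_at M p F U \<psi>"
  shows "chart_inv_deriv U \<psi> p ` F =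
    {v. \<exists>xs ts. (\<forall>j. xs j \<in> M) \<and> (\<forall>j::nat. (0::real) < ts j) \<and> ts \<longlonglongrightarrow> 0 \<and>
          (\<lambda>j. (xs j - p) /\<^sub>R ts j) \<longlonglongrightarrow> v}" (is "?D ` F = ?R")
proof
  let ?g = "inv_into U \<psi>"
  have F: "subspace F" and U: "openin (top_of_set M) U" "p \<in> U"
    and V: "openin (top_of_set F) (\<psi> ` U)" and hom: "homeomorphism U (\<psi> ` U) \<psi> ?g"
    and inj: "inj_on ?D F"
    using ch by (auto simp: chart_at_def)
  have UM: "U \<subseteq> M" using U openin_imp_subset by blast
  note D = chart_inv_has_derivative[OF ch]
  note lin = chart_linear[OF ch]
  have gp: "?g (\<psi> p) = p" by (rule chart_inv_left[OF ch U(2)])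
  show "?D ` F \<subseteq> ?R"
  proof
    fix v assume "v \<in> ?D ` F"
    then obtain w where w: "w \<in> F" and v: "v = ?D w" by blast
    obtain e where e: "e > 0" "ball (\<psi> p) e \<inter> F \<subseteq> \<psi> ` U"
      using V U(2) unfolding openin_contains_ball by blast
    \<comment> \<open>The factor \<open>e / (norm w + 1)\<close> keeps every point inside the ball
      of radius \<open>e\<close>, so that all of them, not only almost all, lie in the domain of the
      parametrization.\<close>
    define ts where "ts j = e / (norm w + 1) * inverse (real (Suc j))" for j
    have pos: "0 < ts j" for j
      unfolding ts_def using e(1) by (intro mult_pos_pos divide_pos_pos) (auto simp: add_nonneg_pos)
    have lim: "ts \<longlonglongrightarrow> 0"
      unfolding ts_def by (intro tendsto_mult_right_zero LIMSEQ_inverse_real_of_nat)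
    have mem: "\<psi> p + ts j *\<^sub>R w \<in> \<psi> ` U" for j
    proof -
      have "ts j \<le> e / (norm w + 1) * 1"
        unfolding ts_def using e(1) by (intro mult_left_mono) (auto simp: field_simps)
      then have "norm (ts j *\<^sub>R w) \<le> e / (norm w + 1) * norm w"
        using pos[of j] mult_right_mono[of "ts j" "e / (norm w + 1)" "norm w"] by simp
      also have "\<dots> < e" using e(1)
        by (simp add: divide_less_eq mult_less_cancel_left_pos add_nonneg_pos)
      finally have "\<psi> p + ts j *\<^sub>R w \<in> ball (\<psi> p) e"
        by (simp add: dist_norm)
      moreover have "\<psi> p + ts j *\<^sub>R w \<in> F"
        using chart_image_subset[OF ch] U(2) w F by (auto intro: subspace_add subspace_scale)
      ultimately show ?thesis using e by blast
    qed
    have "(\<lambda>j. (?g (\<psi> p + ts j *\<^sub>R w) - p) /\<^sub>R ts j) \<longlonglongrightarrow> v"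
      unfolding v using difference_quotient_tendsto[OF D tendsto_const lim pos mem] gp by simp
    moreover have "\<forall>j. ?g (\<psi> p + ts j *\<^sub>R w) \<in> M"
      using UM inv_into_into[OF mem] by blast
    ultimately have "(\<forall>j. ?g (\<psi> p + ts j *\<^sub>R w) \<in> M) \<and> (\<forall>j. 0 < ts j) \<and> ts \<longlonglongrightarrow> 0 \<and>
        (\<lambda>j. (?g (\<psi> p + ts j *\<^sub>R w) - p) /\<^sub>R ts j) \<longlonglongrightarrow> v"
      using pos lim by blast
    then show "v \<in> ?R"
      by (intro CollectI exI[of _ "\<lambda>j. ?g (\<psi> p + ts j *\<^sub>R w)"] exI[of _ ts])
  qed
  show "?R \<subseteq> ?D ` F"
  proof
    fix v assume "v \<in> ?R"
    then obtain xs and ts :: "nat \<Rightarrow> real" where xs: "\<forall>j. xs j \<in> M" and pos: "\<forall>j. 0 < ts j" and lim: "ts \<longlonglongrightarrow> 0"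
      and v: "(\<lambda>j. (xs j - p) /\<^sub>R ts j) \<longlonglongrightarrow> v"
      by blast
    have "(\<lambda>j. ts j *\<^sub>R ((xs j - p) /\<^sub>R ts j)) \<longlonglongrightarrow> 0 *\<^sub>R v"
      by (intro tendsto_scaleR lim v)
    moreover have "ts j *\<^sub>R ((xs j - p) /\<^sub>R ts j) = xs j - p" for j
      using pos by (simp add: less_imp_neq[symmetric])
    ultimately have xp: "xs \<longlonglongrightarrow> p" by (simp add: LIM_zero_iff)
    obtain r where r: "r > 0" "ball p r \<inter> M \<subseteq> U"
      using U unfolding openin_contains_ball by blast
    have "\<forall>\<^sub>F j in sequentially. dist (xs j) p < r"
      using xp r(1) by (simp add: tendsto_iff)
    then have evU: "\<forall>\<^sub>F j in sequentially. xs j \<in> U"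
      by eventually_elim (use r xs in \<open>auto simp: dist_commute\<close>)
    have "continuous_on U \<psi>" using hom by (simp add: homeomorphism_def)
    then have psi: "(\<lambda>j. \<psi> (xs j)) \<longlonglongrightarrow> \<psi> p"
      using continuous_on_tendsto_compose[OF _ xp U(2) evU] by blast
    \<comment> \<open>Only the inverse of the chart is known to be differentiable. Injectivity of
      its derivative on the finite-dimensional \<open>F\<close> gives a lower bound
      \<open>c\<close>, through which the displacement in the chart is controlled by the
      displacement in the ambient space.\<close>
    obtain c where c: "c > 0" "\<And>w. w \<in> F \<Longrightarrow> norm (?D w) \<ge> c * norm w"
    proof -
      have "\<forall>w\<in>F. ?D w = 0 \<longrightarrow> w = 0"
        using inj linear_0[OF lin] subspace_0[OF F] by (metis inj_onD)
      from injective_imp_isometric[OF closed_subspace[OF F] F has_derivative_bounded_linear[OF D] this]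
      show ?thesis using that by (auto simp: mult.commute)
    qed
    obtain B where B: "B > 0" "\<And>j. norm ((xs j - p) /\<^sub>R ts j) \<le> B"
      using convergent_imp_Bseq[OF convergentI[OF v]] by (auto elim: BseqE)
    define f where "f j = ?D ((\<psi> (xs j) - \<psi> p) /\<^sub>R ts j)" for j
    have "(\<lambda>j. (xs j - p) /\<^sub>R ts j - f j) \<longlonglongrightarrow> 0"
    proof (rule tendstoI)
      fix e :: real assume "0 < e"
      \<comment> \<open>The bound \<open>c / 2\<close> lets the remainder be absorbed into
        \<open>c * norm ?z\<close>; the second bound makes the final error at most
        \<open>e / 2\<close>.\<close>
      define h where "h = min (c / 2) (e * c / (4 * B))"
      have h: "h > 0" "h \<le> c / 2" "h * (2 / c) * B < e"
      proof -
        show "h > 0" "h \<le> c / 2" using c(1) B(1) \<open>0 < e\<close> by (auto simp: h_def)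
        have "h * (2 / c) * B \<le> (e * c / (4 * B)) * (2 / c) * B"
          using c(1) B(1) by (intro mult_right_mono) (auto simp: h_def)
        also have "\<dots> = e / 2" using c(1) B(1) by (simp add: field_simps)
        finally show "h * (2 / c) * B < e" using \<open>0 < e\<close> by simp
      qed
      obtain d where d: "d > 0" "\<And>y. y \<in> \<psi> ` U \<Longrightarrow> norm (y - \<psi> p) < d \<Longrightarrow>
          norm (?g y - ?g (\<psi> p) - ?D (y - \<psi> p)) \<le> h * norm (y - \<psi> p)"
        using D h(1) unfolding has_derivative_within_alt by blast
      have "\<forall>\<^sub>F j in sequentially. dist (\<psi> (xs j)) (\<psi> p) < d"
        using psi d(1) by (simp add: tendsto_iff)
      with evU show "\<forall>\<^sub>F j in sequentially. dist ((xs j - p) /\<^sub>R ts j - f j) 0 < e"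
      proof eventually_elim
        case (elim j)
        let ?z = "\<psi> (xs j) - \<psi> p"
        have t: "ts j > 0" using pos by simp
        have z: "?z \<in> F"
          using chart_image_subset[OF ch] elim(1) U(2) F by (blast intro: subspace_diff)
        have 1: "norm (xs j - p - ?D ?z) \<le> h * norm ?z"
          using d(2)[of "\<psi> (xs j)"] elim gp chart_inv_left[OF ch elim(1)] by (simp add: dist_norm)
        have "c * norm ?z \<le> norm (?D ?z)" using c(2)[OF z] .
        also have "\<dots> \<le> norm (xs j - p) + h * norm ?z"
          using 1 norm_triangle_ineq2[of "?D ?z" "xs j - p"] by (simp add: norm_minus_commute)
        also have "\<dots> \<le> norm (xs j - p) + c / 2 * norm ?z"
          using h(2) by (intro add_left_mono mult_right_mono) auto
        finally have "norm ?z \<le> 2 / c * norm (xs j - p)"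
          using c(1) by (simp add: field_simps)
        then have "h * norm ?z \<le> h * (2 / c * norm (xs j - p))"
          using h(1) by (intro mult_left_mono) auto
        with 1 have 2: "norm (xs j - p - ?D ?z) \<le> h * (2 / c) * norm (xs j - p)"
          by (simp add: mult.assoc)
        have "(xs j - p) /\<^sub>R ts j - f j = (xs j - p - ?D ?z) /\<^sub>R ts j"
          unfolding f_def linear_scale[OF lin] by (simp only: scaleR_diff_right)
        then have "norm ((xs j - p) /\<^sub>R ts j - f j) = norm (xs j - p - ?D ?z) / ts j"
          using t by (simp add: divide_inverse mult.commute)
        also have "\<dots> \<le> h * (2 / c) * norm (xs j - p) / ts j"
          using 2 t by (rule divide_right_mono[OF _ less_imp_le])
        also have "\<dots> = h * (2 / c) * norm ((xs j - p) /\<^sub>R ts j)"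
          unfolding norm_scaleR using t by (simp add: field_simps)
        also have "\<dots> \<le> h * (2 / c) * B"
          using B(2)[of j] h(1) c(1) by (intro mult_left_mono) auto
        finally show ?case using h(3) by (simp add: dist_norm)
      qed
    qed
    from tendsto_diff[OF v this] have fv: "f \<longlonglongrightarrow> v" by simp
    have ev: "\<forall>\<^sub>F j in sequentially. f j \<in> ?D ` F"
      using evU
    proof eventually_elim
      case (elim j)
      have "(\<psi> (xs j) - \<psi> p) /\<^sub>R ts j \<in> F"
        using chart_image_subset[OF ch] elim U(2) subspace_scale[OF F subspace_diff[OF F]] by blast
      then show ?case by (simp add: f_def)
    qed
    have cl: "closed (?D ` F)"
      by (intro closed_subspace linear_subspace_image lin F)
    show "v \<in> ?D ` F"
      by (rule Lim_in_closed_set[OF cl ev sequentially_bot fv])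
  qed
qed

lemma tangent_space_chart:
  assumes ch: "chart_at M p F U \<psi>"
  shows "tangent_space M p = chart_inv_deriv U \<psi> p ` F"
proof -
  have "chart_inv_deriv U' \<psi>' p ` F' = chart_inv_deriv U \<psi> p ` F"
    if "chart_at M p F' U' \<psi>'" for F' U' \<psi>'
    unfolding chart_image_eq_sequential_tangents[OF ch] chart_image_eq_sequential_tangents[OF that] ..
  then have "(\<exists>F U \<psi>. chart_at M p F U \<psi> \<and> v \<in> chart_inv_deriv U \<psi> p ` F) \<longleftrightarrow>
      v \<in> chart_inv_deriv U \<psi> p ` F" for v
    using ch by metis
  then show ?thesis
    unfolding tangent_space_def by simp
qed

lemma subspace_tangent_space:
  assumes "chart_at M p F U \<psi>"
  shows "subspace (tangent_space M p)"
  unfolding tangent_space_chart[OF assms]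
  using assms by (intro linear_subspace_image chart_linear) (auto simp: chart_at_def)

lemma tangent_coneE:
  assumes "w \<in> tangent_cone C x" "\<And>j. xs j \<in> C" "xs \<longlonglongrightarrow> x" "\<And>j::nat. (0::real) < ts j" "ts \<longlonglongrightarrow> 0"
  obtains ws where "ws \<longlonglongrightarrow> w" "\<And>j. xs j + ts j *\<^sub>R ws j \<in> C"
proof -
  have "(\<forall>j. xs j \<in> C) \<and> xs \<longlonglongrightarrow> x \<and> (\<forall>j. 0 < ts j) \<and> ts \<longlonglongrightarrow> 0 \<longrightarrow>
      (\<exists>ws. ws \<longlonglongrightarrow> w \<and> (\<forall>j. xs j + ts j *\<^sub>R ws j \<in> C))"
    using assms(1) unfolding tangent_cone_def by (elim CollectE allE)
  then show ?thesis using assms(2-) that by auto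
qed

text \<open>Closure under sums rests on the quantification over all base sequences: after moving
  along \<open>vs\<close>, the points form a new base sequence in \<open>C\<close> that still tends
  to \<open>x\<close>, and the second vector is realized from there. Scaling is a change of the step
  sizes.\<close>

lemma convex_cone_tangent_cone: "convex_cone (tangent_cone C x)"
proof -
  have "0 \<in> tangent_cone C x"
    unfolding tangent_cone_def by (auto intro!: exI[of _ "\<lambda>_. 0"])
  moreover have "v + w \<in> tangent_cone C x" if v: "v \<in> tangent_cone C x" and w: "w \<in> tangent_cone C x" for v w
    unfolding tangent_cone_def
  proof clarify
    fix xs ts
    assume xs: "\<forall>j. xs j \<in> C" "xs \<longlonglongrightarrow> x" and ts: "\<forall>j::nat. (0::real) < ts j" "ts \<longlonglongrightarrow> 0"
    obtain vs where vs: "vs \<longlonglongrightarrow> v" "\<And>j. xs j + ts j *\<^sub>R vs j \<in> C"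
      by (rule tangent_coneE[OF v spec[OF xs(1)] xs(2) spec[OF ts(1)] ts(2)]) blast
    have "(\<lambda>j. xs j + ts j *\<^sub>R vs j) \<longlonglongrightarrow> x + 0 *\<^sub>R v"
      by (intro tendsto_intros xs ts vs)
    then have lim: "(\<lambda>j. xs j + ts j *\<^sub>R vs j) \<longlonglongrightarrow> x" by simp
    obtain us where us: "us \<longlonglongrightarrow> w" "\<And>j. xs j + ts j *\<^sub>R vs j + ts j *\<^sub>R us j \<in> C"
      by (rule tangent_coneE[OF w vs(2) lim spec[OF ts(1)] ts(2)]) blast
    show "\<exists>ws. ws \<longlonglongrightarrow> v + w \<and> (\<forall>j. xs j + ts j *\<^sub>R ws j \<in> C)"
      using tendsto_add[OF vs(1) us(1)] us(2)
      by (intro exI[of _ "\<lambda>j. vs j + us j"]) (simp add: scaleR_add_right add.assoc)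
  qed
  moreover have "c *\<^sub>R v \<in> tangent_cone C x" if v: "v \<in> tangent_cone C x" and c: "c > 0" for c v
    unfolding tangent_cone_def
  proof clarify
    fix xs ts
    assume xs: "\<forall>j. xs j \<in> C" "xs \<longlonglongrightarrow> x" and ts: "\<forall>j::nat. (0::real) < ts j" "ts \<longlonglongrightarrow> 0"
    have cts: "\<And>j. 0 < c * ts j" "(\<lambda>j. c * ts j) \<longlonglongrightarrow> 0"
      using ts c by (auto intro: tendsto_mult_right_zero)
    obtain vs where vs: "vs \<longlonglongrightarrow> v" "\<And>j. xs j + (c * ts j) *\<^sub>R vs j \<in> C"
      by (rule tangent_coneE[OF v spec[OF xs(1)] xs(2) cts]) blast
    show "\<exists>ws. ws \<longlonglongrightarrow> c *\<^sub>R v \<and> (\<forall>j. xs j + ts j *\<^sub>R ws j \<in> C)"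
      using tendsto_scaleR[OF tendsto_const vs(1)] vs(2)
      by (intro exI[of _ "\<lambda>j. c *\<^sub>R vs j"]) (simp add: mult.commute)
  qed
  ultimately show ?thesis
    unfolding convex_cone_iff by (metis less_eq_real_def scaleR_zero_left)
qed

text \<open>A constant base sequence and the steps 1/(j+1) suffice; the parametrization carries the
  points in the chart back to \<open>S\<close>. The bound \<open>ts j \<le> 1\<close> places
  \<open>p + ts j *\<^sub>R v\<close> on the segment from \<open>p\<close> to \<open>p + v\<close>,
  where convexity of the regularizer is applied.\<close>

lemma mfd_tangent_cone_sequence:
  assumes ch: "chart_at M p F U \<psi>" and p: "p \<in> S" and v: "v \<in> mfd_tangent_cone U \<psi> S p"
  obtains vs ts where "vs \<longlonglongrightarrow> v" "ts \<longlonglongrightarrow> 0" "\<And>j::nat. (0::real) < ts j" "\<And>j. ts j \<le> 1"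
    "\<And>j. p + ts j *\<^sub>R vs j \<in> S"
proof -
  let ?g = "inv_into U \<psi>" and ?D = "chart_inv_deriv U \<psi> p"
  have pU: "p \<in> U" using ch by (simp add: chart_at_def)
  obtain w where w: "v = ?D w" "w \<in> tangent_cone (\<psi> ` (S \<inter> U)) (\<psi> p)"
    using v by (auto simp: mfd_tangent_cone_def)
  define ts :: "nat \<Rightarrow> real" where "ts j = inverse (real (Suc j))" for j
  have ts: "ts \<longlonglongrightarrow> 0" "\<And>j. 0 < ts j" "\<And>j. ts j \<le> 1"
    unfolding ts_def using LIMSEQ_inverse_real_of_nat by (auto simp: field_simps)
  have "\<psi> p \<in> \<psi> ` (S \<inter> U)" using p pU by blast
  then obtain ws where ws: "ws \<longlonglongrightarrow> w" "\<And>j. \<psi> p + ts j *\<^sub>R ws j \<in> \<psi> ` (S \<inter> U)"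
    by (rule tangent_coneE[OF w(2) _ tendsto_const ts(2,1)]) blast
  have mem: "?g (\<psi> p + ts j *\<^sub>R ws j) \<in> S" for j
    using ws(2)[of j] chart_inv_left[OF ch] by auto
  have "(\<lambda>j. (?g (\<psi> p + ts j *\<^sub>R ws j) - p) /\<^sub>R ts j) \<longlonglongrightarrow> v"
    using difference_quotient_tendsto[OF chart_inv_has_derivative[OF ch] ws(1) ts(1,2)] ws(2)
      chart_inv_left[OF ch pU] w(1) by fastforce
  moreover have "p + ts j *\<^sub>R ((?g (\<psi> p + ts j *\<^sub>R ws j) - p) /\<^sub>R ts j) \<in> S" for j
    using mem[of j] ts(2)[of j] by simp
  ultimately show ?thesis using that ts by blast
qed

lemma mfd_tangent_cone_subset:
  assumes ch: "chart_at M p F U \<psi>" and S: "S \<subseteq> M" "p \<in> S"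
  shows "mfd_tangent_cone U \<psi> S p \<subseteq> tangent_space M p"
proof
  fix v assume "v \<in> mfd_tangent_cone U \<psi> S p"
  from mfd_tangent_cone_sequence[OF ch S(2) this] obtain vs ts where
    vs: "vs \<longlonglongrightarrow> v" "ts \<longlonglongrightarrow> 0" "\<And>j::nat. (0::real) < ts j" "\<And>j. p + ts j *\<^sub>R vs j \<in> S"
    by metis
  have "(\<lambda>j. (p + ts j *\<^sub>R vs j - p) /\<^sub>R ts j) = vs"
    using vs(3) by (auto simp: fun_eq_iff less_imp_neq[symmetric])
  with vs S have "(\<forall>j. p + ts j *\<^sub>R vs j \<in> M) \<and> (\<forall>j. 0 < ts j) \<and> ts \<longlonglongrightarrow> 0 \<and>
      (\<lambda>j. (p + ts j *\<^sub>R vs j - p) /\<^sub>R ts j) \<longlonglongrightarrow> v"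
    by auto
  then show "v \<in> tangent_space M p"
    unfolding tangent_space_chart[OF ch] chart_image_eq_sequential_tangents[OF ch]
    by (intro CollectI exI[of _ "\<lambda>j. p + ts j *\<^sub>R vs j"] exI[of _ ts])
qed

section \<open>First-order optimality on a submanifold\<close>

text \<open>Separating the strict epigraph of the left-hand side of the assumption from
  \<open>K \<times> {..0}\<close> produces one subgradient that works for all directions.\<close>

lemma convex_cone_multiplier:
  fixes E K :: "'a::euclidean_space set"
  assumes r: "convex_on E r" and E: "subspace E" and p: "p \<in> E" and G: "G \<in> E"
    and K: "convex_cone K" "K \<subseteq> E"
    and nonneg: "\<And>v. v \<in> K \<Longrightarrow> 0 \<le> G \<bullet> v + r (p + v) - r p"
  shows "\<exists>g\<in>subdifferential_on E r p. \<forall>v\<in>K. 0 \<le> (G + g) \<bullet> v"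
proof -
  let ?q = "\<lambda>w. G \<bullet> w + r (p + w) - r p"
  define A where "A = {z. fst z \<in> E \<and> ?q (fst z) < snd z}"
  \<comment> \<open>The orthogonal complement of \<open>E\<close> is added to \<open>K\<close> to
    force the separating normal into \<open>E\<close>. Otherwise a normal orthogonal to
    \<open>E\<close> could separate the two sets trivially.\<close>
  define B where "B = (\<Union>v\<in>K. \<Union>n\<in>E\<^sup>\<bottom>. {v + n}) \<times> {..0::real}"
  have perp: "n \<bullet> w = 0" "w \<bullet> n = 0" if "n \<in> E\<^sup>\<bottom>" "w \<in> E" for n w
    using that by (auto simp: orthogonal_comp_def orthogonal_def inner_commute)
  have sub: "subspace (E\<^sup>\<bottom>)" by (rule subspace_orthogonal_comp)
  have K0: "0 \<in> K" by (rule convex_cone_contains_0[OF K(1)])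
  have "convex A"
    unfolding convex_def
  proof clarify
    fix w s w' s' and u v :: real
    assume A: "(w, s) \<in> A" "(w', s') \<in> A" and uv: "0 \<le> u" "0 \<le> v" "u + v = 1"
    have E': "w \<in> E" "w' \<in> E" and s: "?q w < s" "?q w' < s'" using A by (auto simp: A_def)
    have "p + (u *\<^sub>R w + v *\<^sub>R w') = (u + v) *\<^sub>R p + (u *\<^sub>R w + v *\<^sub>R w')" by (simp add: uv)
    also have "\<dots> = u *\<^sub>R (p + w) + v *\<^sub>R (p + w')" by (simp add: algebra_simps)
    finally have "r (p + (u *\<^sub>R w + v *\<^sub>R w')) \<le> u * r (p + w) + v * r (p + w')"
      using r uv E' p E unfolding convex_on_def by (auto simp: subspace_add)
    moreover have "u * r p + v * r p = r p" using uv by (metis distrib_right mult_1)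
    ultimately have "?q (u *\<^sub>R w + v *\<^sub>R w') \<le> u * ?q w + v * ?q w'"
      by (simp add: algebra_simps inner_add_right)
    also have "\<dots> < u * s + v * s'"
    proof (cases "u = 0")
      case True then show ?thesis using s uv by simp
    next
      case False
      then show ?thesis using s uv by (intro add_less_le_mono mult_strict_left_mono mult_left_mono) auto
    qed
    finally show "u *\<^sub>R (w, s) + v *\<^sub>R (w', s') \<in> A"
      using E' E by (auto simp: A_def intro: subspace_add subspace_scale)
  qed
  moreover have "convex B"
    unfolding B_def using K(1) sub
    by (intro convex_Times convex_sums) (auto simp: convex_cone_def subspace_imp_convex)
  moreover have AI: "(w, s) \<in> A" if "w \<in> E" "?q w < s" for w s
    using that by (simp add: A_def)
  moreover have BI: "(v + n, s) \<in> B" if "v \<in> K" "n \<in> E\<^sup>\<bottom>" "s \<le> 0" for v n s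
    using that by (auto simp: B_def)
  moreover have "A \<inter> B = {}"
  proof -
    have False if v: "v \<in> K" "n \<in> E\<^sup>\<bottom>" "s \<le> 0" "v + n \<in> E" "?q (v + n) < s" for v n s
    proof -
      have "n \<in> E" using v K(2) E subspace_diff[OF E v(4), of v] by auto
      then have "n = 0" using perp[OF v(2)] by (metis inner_eq_zero_iff)
      then show False using nonneg[OF v(1)] v(3,5) by simp
    qed
    then show ?thesis by (auto simp: A_def B_def)
  qed
  moreover have A0: "(0, s) \<in> A" if "s > 0" for s
    using that by (intro AI) (auto simp: subspace_0[OF E])
  moreover have "A \<noteq> {}" "B \<noteq> {}"
    using A0[of 1] BI[OF K0 subspace_0[OF sub], of 0] by auto
  ultimately obtain ab c where ab: "ab \<noteq> 0" "\<And>z. z \<in> B \<Longrightarrow> ab \<bullet> z \<le> c" "\<And>z. z \<in> A \<Longrightarrow> c \<le> ab \<bullet> z"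
    using separating_hyperplane_sets[of B A] by (metis Int_commute)
  obtain a b where ab_eq: "ab = (a, b)" by (cases ab)
  have B': "a \<bullet> (v + n) + b * s \<le> c" if "v \<in> K" "n \<in> E\<^sup>\<bottom>" "s \<le> 0" for v n s
    using ab(2)[OF BI[OF that]] by (simp add: ab_eq)
  have A': "c \<le> a \<bullet> w + b * s" if "w \<in> E" "?q w < s" for w s
    using ab(3)[OF AI[OF that]] by (simp add: ab_eq)
  have "c \<ge> 0" using B'[OF K0 subspace_0[OF sub], of 0] by simp
  \<comment> \<open>\<open>B\<close> is unbounded downwards in its last coordinate.\<close>
  have "b \<ge> 0"
  proof (rule ccontr)
    assume "\<not> b \<ge> 0"
    then have "b * (- (c + 1) / - b) \<le> c" "- (c + 1) / - b \<ge> 0"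
      using B'[OF K0 subspace_0[OF sub], of "(c + 1) / b"] \<open>c \<ge> 0\<close>
      by (auto simp: divide_nonneg_neg divide_nonpos_neg divide_nonneg_neg)
    then show False using \<open>\<not> b \<ge> 0\<close> by (simp add: field_simps)
  qed
  \<comment> \<open>\<open>A\<close> contains points \<open>(0, s)\<close> with \<open>s > 0\<close>
    arbitrarily small.\<close>
  have "c \<le> 0"
  proof (rule field_le_epsilon)
    fix e :: real assume "e > 0"
    have "c \<le> b * (e / (b + 1))"
      using A'[OF subspace_0[OF E], of "e / (b + 1)"] \<open>e > 0\<close> \<open>b \<ge> 0\<close> by (simp add: add_nonneg_pos)
    also have "\<dots> \<le> e" using \<open>e > 0\<close> \<open>b \<ge> 0\<close> by (simp add: field_simps)
    finally show "c \<le> 0 + e" by simp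
  qed
  with \<open>c \<ge> 0\<close> have "c = 0" by simp
  have aE: "a \<in> E"
  proof -
    have "a \<bullet> n = 0" if n: "n \<in> E\<^sup>\<bottom>" for n
    proof -
      have "a \<bullet> n \<le> 0" "a \<bullet> (- n) \<le> 0"
        using B'[OF K0 n, of 0] B'[OF K0 subspace_neg[OF sub n], of 0] \<open>c = 0\<close> by simp_all
      then show ?thesis by simp
    qed
    then have "a \<in> E\<^sup>\<bottom>\<^sup>\<bottom>" by (auto simp: orthogonal_comp_def[of "E\<^sup>\<bottom>"] orthogonal_def inner_commute)
    then show ?thesis by (simp add: orthogonal_comp_self[OF E])
  qed
  \<comment> \<open>A vertical hyperplane is impossible because \<open>A\<close> projects onto all
    of \<open>E\<close>: testing with \<open>- a\<close> would force \<open>a = 0\<close>.\<close>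
  have "b \<noteq> 0"
  proof
    assume b: "b = 0"
    have "0 \<le> a \<bullet> (- a)"
      using A'[of "- a" "?q (- a) + 1"] aE b \<open>c = 0\<close> by (simp add: subspace_neg[OF E])
    then have "a \<bullet> a = 0" using inner_ge_zero[of a] by simp
    then have "a = 0" by simp
    with b ab(1) ab_eq show False by (simp add: zero_prod_def)
  qed
  with \<open>b \<ge> 0\<close> have b: "b > 0" by simp
  \<comment> \<open>The hyperplane supports \<open>?q\<close> at 0 with slope
    \<open>- (a /\<^sub>R b)\<close>; removing the linear part \<open>G\<close> leaves a subgradient
    of \<open>r\<close> itself.\<close>
  define g where "g = - (a /\<^sub>R b) - G"
  have "g \<in> subdifferential_on E r p"
    unfolding subdifferential_on_def
  proof (intro CollectI conjI ballI)
    show "g \<in> E" unfolding g_def using aE G E by (intro subspace_diff subspace_neg subspace_scale)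
    fix y assume y: "y \<in> E"
    have "- (a \<bullet> (y - p)) / b \<le> ?q (y - p)"
    proof (rule dense_ge)
      fix s assume "?q (y - p) < s"
      then have "0 \<le> a \<bullet> (y - p) + b * s"
        using A'[of "y - p" s] y p \<open>c = 0\<close> by (simp add: subspace_diff[OF E])
      then show "- (a \<bullet> (y - p)) / b \<le> s" using b by (simp add: field_simps)
    qed
    then show "r p + g \<bullet> (y - p) \<le> r y"
      by (simp add: g_def inner_diff_left divide_inverse mult.commute)
  qed
  moreover have "0 \<le> (G + g) \<bullet> v" if "v \<in> K" for v
    using B'[OF that subspace_0[OF sub], of 0] \<open>c = 0\<close> b
    by (simp add: g_def divide_nonpos_pos mult_nonneg_nonpos)
  ultimately show ?thesis by blast
qed

lemma inner_closest_point_subspace: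
  fixes T :: "'a::euclidean_space set"
  assumes T: "subspace T" and v: "v \<in> T"
  shows "closest_point T u \<bullet> v = u \<bullet> v"
proof -
  have cc: "convex T" "closed T" "T \<noteq> {}"
    using T closed_subspace subspace_imp_convex subspace_0 by auto
  have c: "closest_point T u \<in> T" by (rule closest_point_in_set[OF cc(2,3)])
  have "(u - closest_point T u) \<bullet> w \<le> 0" if "w \<in> T" for w
    using closest_point_dot[OF cc(1,2) subspace_add[OF T c that], of u] by simp
  from this[OF v] this[OF subspace_neg[OF T v]] show ?thesis
    by (simp add: inner_diff_left)
qed

text \<open>Minimality along a feasible sequence is divided by the step size. Convexity bounds the
  quotient of \<open>r\<close> in the fixed direction \<open>v\<close> by
  \<open>r (p + v) - r p\<close>, and the local Lipschitz bound pays for replacing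
  \<open>vs j\<close> by \<open>v\<close>. The limit is the hypothesis of
  \<open>convex_cone_multiplier\<close>. Projecting onto the tangent space does not change inner
  products with the cone, which lies inside it.\<close>

lemma minimizer_mfd_stationary:
  fixes M S E :: "'a::euclidean_space set"
  assumes ch: "chart_at M p F U \<psi>" and S: "S \<subseteq> M" "p \<in> S" and E: "subspace E" "S \<subseteq> E"
    and r: "convex_on E r" and lip: "e > 0" "C-lipschitz_on (cball p e \<inter> E) r"
    and q: "GDERIV q p :> G" "G \<in> E"
    and min: "\<And>u. u \<in> S \<Longrightarrow> q p + r p \<le> q u + r u"
  shows "\<exists>g\<in>subdifferential_on E r p.
    closest_point (tangent_space M p) (- G - g) \<in> mfd_normal_cone M U \<psi> S p"
proof -
  let ?K = "mfd_tangent_cone U \<psi> S p" and ?T = "tangent_space M p"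
  have pE: "p \<in> E" using S E by auto
  have K: "v \<in> E \<and> 0 \<le> G \<bullet> v + r (p + v) - r p" if v: "v \<in> ?K" for v
  proof -
    obtain vs ts where vs: "vs \<longlonglongrightarrow> v" "ts \<longlonglongrightarrow> 0" "\<And>j::nat. (0::real) < ts j" "\<And>j. ts j \<le> 1"
      "\<And>j. p + ts j *\<^sub>R vs j \<in> S"
      using mfd_tangent_cone_sequence[OF ch S(2) v] by metis
    have vsE: "vs j \<in> E" for j
    proof -
      have "(p + ts j *\<^sub>R vs j - p) /\<^sub>R ts j \<in> E"
        using vs(5)[of j] E pE by (intro subspace_scale subspace_diff) auto
      then show ?thesis using vs(3)[of j] by simp
    qed
    have vE: "v \<in> E"
      using Lim_in_closed_set[OF closed_subspace[OF E(1)] _ _ vs(1)] vsE by simp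
    have inE: "p + t *\<^sub>R u \<in> E" if "u \<in> E" for t u
      using that pE E(1) by (intro subspace_add subspace_scale)
    have "(\<lambda>j. p + ts j *\<^sub>R v) \<longlonglongrightarrow> p + 0 *\<^sub>R v" "(\<lambda>j. p + ts j *\<^sub>R vs j) \<longlonglongrightarrow> p + 0 *\<^sub>R v"
      by (intro tendsto_intros vs)+
    then have near: "\<forall>\<^sub>F j in sequentially. dist (p + ts j *\<^sub>R v) p < e"
      "\<forall>\<^sub>F j in sequentially. dist (p + ts j *\<^sub>R vs j) p < e"
      using lip(1) by (simp_all add: tendsto_iff)
    have "\<forall>\<^sub>F j in sequentially. 0 \<le> (q (p + ts j *\<^sub>R vs j) - q p) /\<^sub>R ts j
        + C * norm (vs j - v) + (r (p + v) - r p)"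
      using near
    proof eventually_elim
      case (elim j)
      let ?t = "ts j"
      have t: "0 < ?t" "?t \<le> 1" using vs by auto
      have *: "(a + ?t * b + ?t * d) / ?t = a /\<^sub>R ?t + b + d" for a b d :: real
        using t by (simp add: field_simps)
      have "p + ?t *\<^sub>R v = (1 - ?t) *\<^sub>R p + ?t *\<^sub>R (p + v)" by (simp add: algebra_simps)
      then have 1: "r (p + ?t *\<^sub>R v) \<le> (1 - ?t) * r p + ?t * r (p + v)"
        using convex_onD[OF r, of ?t p "p + v"] t pE vE E(1) by (simp add: subspace_add)
      have "dist (r (p + ?t *\<^sub>R vs j)) (r (p + ?t *\<^sub>R v)) \<le> C * dist (p + ?t *\<^sub>R vs j) (p + ?t *\<^sub>R v)"
        using lip(2) elim inE vE vsE by (intro lipschitz_onD) (auto simp: dist_commute less_imp_le)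
      also have "dist (p + ?t *\<^sub>R vs j) (p + ?t *\<^sub>R v) = ?t * norm (vs j - v)"
        using t by (simp add: dist_norm flip: scaleR_diff_right)
      finally have 2: "r (p + ?t *\<^sub>R vs j) \<le> r (p + ?t *\<^sub>R v) + ?t * (C * norm (vs j - v))"
        by (simp add: dist_real_def abs_le_iff mult.left_commute)
      have "0 \<le> (q (p + ?t *\<^sub>R vs j) - q p) + ?t * (C * norm (vs j - v)) + ?t * (r (p + v) - r p)"
        using min[OF vs(5)[of j]] 1 2 by (simp add: algebra_simps)
      then have "0 \<le> ((q (p + ?t *\<^sub>R vs j) - q p) + ?t * (C * norm (vs j - v)) + ?t * (r (p + v) - r p)) / ?t"
        using t by simp
      also have "\<dots> = (q (p + ?t *\<^sub>R vs j) - q p) /\<^sub>R ?t + C * norm (vs j - v) + (r (p + v) - r p)"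
        by (rule *)
      finally show ?case .
    qed
    moreover have "(\<lambda>j. (q (p + ts j *\<^sub>R vs j) - q p) /\<^sub>R ts j + C * norm (vs j - v) + (r (p + v) - r p))
        \<longlonglongrightarrow> v \<bullet> G + C * norm (v - v) + (r (p + v) - r p)"
      by (intro tendsto_intros difference_quotient_tendsto[OF q(1)[unfolded gderiv_def]] vs) simp
    ultimately have "0 \<le> v \<bullet> G + C * norm (v - v) + (r (p + v) - r p)"
      using tendsto_lowerbound sequentially_bot by blast
    then show ?thesis using vE by (simp add: inner_commute)
  qed
  have "convex_cone ?K"
    unfolding mfd_tangent_cone_def
    by (intro convex_cone_linear_image conjI convex_cone_tangent_cone chart_linear[OF ch])
  from convex_cone_multiplier[OF r E(1) pE q(2) this] K
  obtain g where g: "g \<in> subdifferential_on E r p" "\<And>v. v \<in> ?K \<Longrightarrow> 0 \<le> (G + g) \<bullet> v"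
    by blast
  note T = subspace_tangent_space[OF ch]
  have "closest_point ?T (- G - g) \<in> ?T"
    using T by (intro closest_point_in_set closed_subspace) (auto dest: subspace_0)
  moreover have "closest_point ?T (- G - g) \<bullet> v \<le> 0" if "v \<in> ?K" for v
  proof -
    have "v \<in> ?T" using mfd_tangent_cone_subset[OF ch S] that by blast
    then show ?thesis
      using g(2)[OF that] by (simp add: inner_closest_point_subspace[OF T] inner_diff_left inner_add_left)
  qed
  ultimately show ?thesis using g(1) unfolding mfd_normal_cone_def by blast
qed

section \<open>Gradients\<close>

lemma GDERIV_unique:
  assumes "GDERIV f x :> D" "GDERIV f x :> E"
  shows "D = E"
proof -
  have "(\<lambda>h. h \<bullet> D) = (\<lambda>h. h \<bullet> E)"
    using assms unfolding gderiv_def by (rule has_derivative_unique)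
  then show ?thesis by (simp add: fun_eq_iff vector_eq_ldot)
qed

lemma GDERIV_grad:
  assumes "f differentiable (at x)"
  shows "GDERIV f x :> grad f x"
proof -
  obtain D where D: "(f has_derivative D) (at x)"
    using assms by (auto simp: differentiable_def)
  have lin: "linear D" using D by (rule has_derivative_linear)
  define d where "d = (\<Sum>b\<in>Basis. D b *\<^sub>R b)"
  have "D h = h \<bullet> d" for h
  proof -
    have "D h = D (\<Sum>b\<in>Basis. (h \<bullet> b) *\<^sub>R b)" by (simp add: euclidean_representation)
    also have "\<dots> = (\<Sum>b\<in>Basis. (h \<bullet> b) * D b)" by (simp add: linear_sum[OF lin] linear_scale[OF lin])
    also have "\<dots> = h \<bullet> d" by (simp add: d_def inner_sum_right mult.commute)
    finally show ?thesis .
  qed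
  then have "D = (\<lambda>h. h \<bullet> d)" by (rule ext)
  then have "GDERIV f x :> d" using D by (simp add: gderiv_def)
  then show ?thesis
    unfolding grad_def by (rule theI) (rule GDERIV_unique[OF _ \<open>GDERIV f x :> d\<close>])
qed

section \<open>Blocks of coordinates\<close>

context
  fixes P :: "('d::finite, 'm::finite) problem"
begin

lemma linear_block: "linear (block P i)"
  by (rule linearI) (auto simp: block_def vec_eq_iff)

lemmas block_add = linear_add[OF linear_block]
  and block_diff = linear_diff[OF linear_block]
  and block_scaleR = linear_scale[OF linear_block]
  and block_zero = linear_0[OF linear_block]

lemma block_block: "block P i (block P j x) = (if i = j then block P i x else 0)"
  by (auto simp: block_def vec_eq_iff)

lemma inner_block_left: "block P i x \<bullet> y = x \<bullet> block P i y"
  unfolding inner_vec_def by (rule sum.cong) (auto simp: block_def)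

lemma inner_block_block: "block P i x \<bullet> block P i y = block P i x \<bullet> y"
  by (simp add: inner_block_left block_block)

lemma norm_block_le: "norm (block P i x) \<le> norm x"
  by (rule norm_le_componentwise_cart) (simp add: block_def)

lemma block_in_block_space: "block P i x \<in> block_space P i"
  by (simp add: block_space_def block_def)

lemma subspace_block_space: "subspace (block_space P i)"
  by (auto simp: subspace_def block_space_def)

lemma replace_block_eq: "replace_block P i x u = x + block P i (u - x)"
  by (auto simp: replace_block_def block_def vec_eq_iff)

lemma block_replace_block:
  "block P j (replace_block P i x u) = (if j = i then block P i u else block P j x)"
  by (auto simp: replace_block_def block_def vec_eq_iff)

lemma col_block_mult: "col_block P i *v x = cmat P *v block P i x"
  by (auto simp: col_block_def block_def matrix_vector_mult_def vec_eq_iff intro!: sum.cong)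

lemma transpose_col_block_mult: "transpose (col_block P i) *v l = block P i (transpose (cmat P) *v l)"
  by (auto simp: col_block_def block_def matrix_vector_mult_def transpose_def vec_eq_iff intro!: sum.cong)

lemma inner_block_transpose: "block P i (transpose (cmat P) *v l) \<bullet> x = l \<bullet> (cmat P *v block P i x)"
  by (metis inner_block_left dot_lmul_matrix transpose_matrix_vector)

lemma residual_add: "residual P (x + y) = residual P x + cmat P *v y"
  by (simp add: residual_def matrix_vector_right_distrib)

lemma block_mixed_point:
  "block P j (mixed_point P i y x) = (if j < i then block P j y else block P j x)"
  by (auto simp: mixed_point_def block_def vec_eq_iff)

lemma mixed_point_Suc: "mixed_point P (Suc i) y x = mixed_point P i y x + block P i (y - x)"
  by (auto simp: mixed_point_def block_def vec_eq_iff less_Suc_eq)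

lemma norm_diff_mixed_point_le: "norm (y - mixed_point P i y x) \<le> norm (y - x)"
  by (rule norm_le_componentwise_cart) (simp add: mixed_point_def)

text \<open>The derivative of inserting a block is the projection \<open>block P i\<close>, which is
  self-adjoint and so can be moved onto the gradient.\<close>

lemma partial_grad_eq:
  assumes "GDERIV F x :> D"
  shows "partial_grad P i F x = block P i D"
proof -
  have "((\<lambda>z. replace_block P i x z) has_derivative block P i) (at x)"
    unfolding replace_block_eq
    by (auto intro!: derivative_eq_intros linear_imp_has_derivative linear_block
      simp: block_diff intro: has_derivative_eq_rhs)
  moreover have "(F has_derivative (\<lambda>h. h \<bullet> D)) (at (replace_block P i x x))"
    using assms by (simp add: gderiv_def replace_block_eq block_zero)
  ultimately have "((\<lambda>z. F (replace_block P i x z)) has_derivative (\<lambda>h. block P i h \<bullet> D)) (at x)"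
    by (rule has_derivative_compose)
  then have "GDERIV (\<lambda>z. F (replace_block P i x z)) x :> block P i D"
    by (simp add: gderiv_def inner_block_left)
  then show ?thesis
    unfolding partial_grad_def grad_def by (intro the_equality GDERIV_unique)
qed

end

lemma block_decomposition:
  fixes P :: "('d::finite, 'm::finite) problem"
  assumes "range (label P) = {1..<nblocks P}"
  shows "(\<Sum>i\<in>{1..nblocks P}. (norm (block P i x))\<^sup>2) = (norm x)\<^sup>2"
    and "(\<Sum>i\<in>{1..nblocks P}. block P i x) = x"
proof -
  have bo: "block_of P c \<in> {1..nblocks P}" for c
  proof (cases c)
    case (Inl j)
    have "label P j \<in> {1..<nblocks P}" using assms by blast
    then show ?thesis by (simp add: Inl block_of_def)
  next
    case (Inr k)
    \<comment> \<open>Any label at all shows that \<open>{1..<nblocks P}\<close> is nonempty, so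
      that the last index lies in \<open>{1..nblocks P}\<close>.\<close>
    have "label P undefined \<in> {1..<nblocks P}" using assms by blast
    then show ?thesis by (simp add: Inr block_of_def)
  qed
  show s: "(\<Sum>i\<in>{1..nblocks P}. block P i x) = x"
    using bo by (auto simp: vec_eq_iff block_def sum.delta)
  have "(norm x)\<^sup>2 = (\<Sum>i\<in>{1..nblocks P}. block P i x) \<bullet> x"
    unfolding s by (simp add: power2_norm_eq_inner)
  also have "\<dots> = (\<Sum>i\<in>{1..nblocks P}. (norm (block P i x))\<^sup>2)"
    unfolding inner_sum_left power2_norm_eq_inner inner_block_block ..
  finally show "(\<Sum>i\<in>{1..nblocks P}. (norm (block P i x))\<^sup>2) = (norm x)\<^sup>2" ..
qed

text \<open>Here the assumption that the last matrix is the identity enters: the last block and the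
  multiplier space differ only by the relabelling \<open>Inr\<close>.\<close>

lemma block_last_transpose:
  fixes P :: "('d::finite, 'm::finite) problem"
  assumes lab: "range (label P) = {1..<nblocks P}"
    and id: "\<forall>r s. cmat P $ r $ Inr s = (if r = s then 1 else 0)"
  shows "block P (nblocks P) (transpose (cmat P) *v l) = (\<chi> c. case c of Inl _ \<Rightarrow> 0 | Inr s \<Rightarrow> l $ s)"
    and "cmat P *v block P (nblocks P) x = (\<chi> s. x $ Inr s)"
proof -
  have "label P j < nblocks P" for j using lab by (metis atLeastLessThan_iff rangeI)
  then have bo: "block_of P (Inl j) \<noteq> nblocks P" "block_of P (Inr s) = nblocks P" for j s
    by (auto simp: block_of_def less_imp_neq)
  show "block P (nblocks P) (transpose (cmat P) *v l) = (\<chi> c. case c of Inl _ \<Rightarrow> 0 | Inr s \<Rightarrow> l $ s)"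
    using bo id by (auto simp: vec_eq_iff block_def matrix_vector_mult_def transpose_def if_distrib[of "\<lambda>t. t * _"]
      split: sum.split cong: if_cong)
  have inj: "inj (Inr :: 'm \<Rightarrow> 'd + 'm)" by simp
  show "cmat P *v block P (nblocks P) x = (\<chi> s. x $ Inr s)"
  proof (simp add: vec_eq_iff, intro allI)
    fix r
    have "(cmat P *v block P (nblocks P) x) $ r = (\<Sum>c\<in>UNIV. cmat P $ r $ c * (block P (nblocks P) x) $ c)"
      by (simp add: matrix_vector_mult_def)
    also have "\<dots> = (\<Sum>c\<in>range Inr. cmat P $ r $ c * (block P (nblocks P) x) $ c)"
    proof (rule sum.mono_neutral_right)
      show "\<forall>c\<in>UNIV - range Inr. cmat P $ r $ c * block P (nblocks P) x $ c = 0"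
      proof
        fix c :: "'d + 'm" assume "c \<in> UNIV - range Inr"
        then obtain j where "c = Inl j" by (cases c) auto
        then show "cmat P $ r $ c * block P (nblocks P) x $ c = 0" using bo by (simp add: block_def)
      qed
    qed auto
    also have "\<dots> = (\<Sum>s\<in>UNIV. (if r = s then 1 else 0) * x $ Inr s)"
      using bo id by (simp add: sum.reindex[OF inj] block_def)
    also have "\<dots> = x $ Inr r" by (simp add: if_distrib[of "\<lambda>t. t * _"] cong: if_cong)
    finally show "(cmat P *v block P (nblocks P) x) $ r = x $ Inr r" .
  qed
qed

section \<open>Smooth functions, matrices\<close>

text \<open>The descent lemma, proved without integration: subtracting the claimed bound from
  \<open>f\<close> along the segment leaves a function with nonpositive derivative.\<close>

lemma Lipschitz_gradient_upper_bound:
  assumes f: "\<And>x. f differentiable (at x)" and lip: "L-lipschitz_on UNIV (grad f)"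
  shows "f (x + d) \<le> f x + grad f x \<bullet> d + L / 2 * (norm d)\<^sup>2"
proof -
  define h where "h t = f (x + t *\<^sub>R d) - t * (grad f x \<bullet> d) - L / 2 * t\<^sup>2 * (norm d)\<^sup>2" for t
  have deriv: "(h has_real_derivative grad f (x + t *\<^sub>R d) \<bullet> d - grad f x \<bullet> d - L * t * (norm d)\<^sup>2) (at t)" for t
  proof -
    have "((\<lambda>t. x + t *\<^sub>R d) has_derivative (\<lambda>t. t *\<^sub>R d)) (at t)"
      by (auto intro!: derivative_eq_intros)
    moreover have "(f has_derivative (\<lambda>h. h \<bullet> grad f (x + t *\<^sub>R d))) (at (x + t *\<^sub>R d))"
      using GDERIV_grad[OF f] by (simp add: gderiv_def)
    ultimately have "((\<lambda>t. f (x + t *\<^sub>R d)) has_derivative (\<lambda>s. (s *\<^sub>R d) \<bullet> grad f (x + t *\<^sub>R d))) (at t)"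
      by (rule has_derivative_compose)
    then have "((\<lambda>t. f (x + t *\<^sub>R d)) has_real_derivative grad f (x + t *\<^sub>R d) \<bullet> d) (at t)"
      by (simp add: has_field_derivative_def inner_commute mult_commute_abs)
    then show ?thesis
      unfolding h_def by (auto intro!: derivative_eq_intros)
  qed
  have "h 1 \<le> h 0"
  proof (rule DERIV_nonpos_imp_nonincreasing[where f = h and a = 0 and b = 1])
    fix t :: real assume t: "0 \<le> t" "t \<le> 1"
    have "(grad f (x + t *\<^sub>R d) - grad f x) \<bullet> d \<le> norm (grad f (x + t *\<^sub>R d) - grad f x) * norm d"
      by (rule norm_cauchy_schwarz)
    also have "\<dots> \<le> (L * norm (t *\<^sub>R d)) * norm d"
      using lipschitz_onD[OF lip, of "x + t *\<^sub>R d" x] by (intro mult_right_mono) (auto simp: dist_norm)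
    also have "\<dots> = L * t * (norm d)\<^sup>2" using t by (simp add: power2_eq_square)
    finally show "\<exists>y. (h has_real_derivative y) (at t) \<and> y \<le> 0"
      using deriv[of t] by (auto simp: inner_diff_left)
  qed simp
  then show ?thesis by (simp add: h_def)
qed

text \<open>Makes the \<open>Min\<close> in \<open>sigma_min_on\<close> meaningful. Eigenvectors for
  distinct eigenvalues are orthogonal, hence independent, and an independent set is finite.\<close>

lemma finite_eigenvalues_on:
  fixes B :: "real^'n^'n"
  assumes sym: "transpose B = B"
  shows "finite {\<mu>. \<exists>v\<in>E. v \<noteq> 0 \<and> B *v v = \<mu> *\<^sub>R v}" (is "finite ?S")
proof -
  define w where "w \<mu> = (SOME v. v \<noteq> 0 \<and> B *v v = \<mu> *\<^sub>R v)" for \<mu>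
  have w: "w \<mu> \<noteq> 0 \<and> B *v w \<mu> = \<mu> *\<^sub>R w \<mu>" if "\<mu> \<in> ?S" for \<mu>
    unfolding w_def by (rule someI_ex) (use that in blast)
  have orth: "w \<mu> \<bullet> w \<nu> = 0" if "\<mu> \<in> ?S" "\<nu> \<in> ?S" "\<mu> \<noteq> \<nu>" for \<mu> \<nu>
  proof -
    have "\<mu> * (w \<mu> \<bullet> w \<nu>) = (B *v w \<mu>) \<bullet> w \<nu>" using w[OF that(1)] by simp
    also have "\<dots> = w \<mu> \<bullet> (B *v w \<nu>)" by (metis dot_lmul_matrix sym transpose_matrix_vector)
    also have "\<dots> = \<nu> * (w \<mu> \<bullet> w \<nu>)" using w[OF that(2)] by simp
    finally show ?thesis using that(3) by simp
  qed
  have "inj_on w ?S"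
  proof (rule inj_onI, rule ccontr)
    fix \<mu> \<nu> assume mem: "\<mu> \<in> ?S" "\<nu> \<in> ?S" and "w \<mu> = w \<nu>" "\<mu> \<noteq> \<nu>"
    then have "w \<mu> = 0" using orth[OF mem] by simp
    then show False using w[OF mem(1)] by blast
  qed
  moreover have "independent (w ` ?S)"
  proof (rule pairwise_orthogonal_independent)
    show "pairwise orthogonal (w ` ?S)"
      unfolding pairwise_def orthogonal_def using orth by fast
    show "0 \<notin> w ` ?S" using w by force
  qed
  then have "finite (w ` ?S)" by (rule independent_imp_finite)
  ultimately show ?thesis by (rule finite_imageD[rotated])
qed

text \<open>The Rayleigh quotient attains its minimum on the compact unit sphere of
  \<open>E\<close>, and a minimizer is an eigenvector. Invariance of \<open>E\<close> keeps the
  comparison direction used below inside \<open>E\<close>.\<close>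

lemma minimal_eigenvector:
  fixes B :: "real^'n^'n"
  assumes sym: "transpose B = B" and E: "subspace E" "E \<noteq> {0}" and BE: "\<And>v. v \<in> E \<Longrightarrow> B *v v \<in> E"
  obtains v \<mu> where "v \<in> E" "norm v = 1" "B *v v = \<mu> *\<^sub>R v"
    "\<And>w. w \<in> E \<Longrightarrow> \<mu> * (norm w)\<^sup>2 \<le> w \<bullet> (B *v w)"
proof -
  let ?q = "\<lambda>v. v \<bullet> (B *v v)"
  obtain e where e: "e \<in> E" "e \<noteq> 0" using E subspace_0 by blast
  have "sgn e \<in> E" unfolding sgn_div_norm using E(1) e(1) by (rule subspace_scale)
  then have "sgn e \<in> E \<inter> sphere 0 1" using e by (simp add: norm_sgn)
  moreover have "compact (E \<inter> sphere 0 1)"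
    using closed_subspace[OF E(1)] by (intro closed_Int_compact) auto
  moreover have "continuous_on (E \<inter> sphere 0 1) ?q"
    by (intro continuous_intros linear_continuous_on matrix_vector_mul_bounded_linear)
  ultimately have "\<exists>v\<in>E \<inter> sphere 0 1. \<forall>w\<in>E \<inter> sphere 0 1. ?q v \<le> ?q w"
    by (intro continuous_attains_inf) blast+
  then obtain v where v: "v \<in> E" "norm v = 1" and min: "\<And>w. w \<in> E \<Longrightarrow> norm w = 1 \<Longrightarrow> ?q v \<le> ?q w"
    by auto
  define \<mu> where "\<mu> = ?q v"
  have bound: "\<mu> * (norm w)\<^sup>2 \<le> ?q w" if w: "w \<in> E" for w
  proof (cases "w = 0")
    case False
    have "sgn w \<in> E" unfolding sgn_div_norm using E(1) w by (rule subspace_scale)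
    then have "\<mu> \<le> ?q (sgn w)" unfolding \<mu>_def using False by (intro min) (simp_all add: norm_sgn)
    also have "?q (sgn w) = ?q w / (norm w)\<^sup>2"
      by (simp add: sgn_div_norm matrix_vector_mult_scaleR power2_eq_square divide_inverse)
    finally show ?thesis using False by (simp add: field_simps)
  qed simp
  have symB: "u \<bullet> (B *v w) = w \<bullet> (B *v u)" for u w
    by (metis dot_lmul_matrix sym transpose_matrix_vector inner_commute)
  \<comment> \<open>If \<open>v\<close> were no eigenvector, this defect would be a direction of
    strict first-order decrease of \<open>?q\<close> minus \<open>\<mu>\<close> times the squared
    norm.\<close>
  define d where "d = \<mu> *\<^sub>R v - B *v v"
  have d: "d \<in> E" unfolding d_def using E(1) v BE by (intro subspace_diff subspace_scale)
  have "d = 0"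
  proof (rule ccontr)
    assume "d \<noteq> 0"
    define a where "a = (norm d)\<^sup>2"
    have "a > 0" using \<open>d \<noteq> 0\<close> by (simp add: a_def)
    define c where "c = ?q d - \<mu> * (norm d)\<^sup>2"
    have c: "c \<ge> 0" using bound[OF d] by (simp add: c_def)
    \<comment> \<open>Chosen so that \<open>t * c \<le> a\<close>, which contradicts the inequality
      \<open>2 * a \<le> t * c\<close> forced by minimality.\<close>
    define t where "t = a / (c + 1)"
    have t: "t > 0" using \<open>a > 0\<close> c by (simp add: t_def)
    have "v + t *\<^sub>R d \<in> E" using E(1) v d by (intro subspace_add subspace_scale)
    from bound[OF this] have "0 \<le> ?q (v + t *\<^sub>R d) - \<mu> * (norm (v + t *\<^sub>R d))\<^sup>2" by simp
    also have "\<dots> = ?q v - \<mu> * (v \<bullet> v) + 2 * t * (d \<bullet> (B *v v) - \<mu> * (d \<bullet> v)) + t\<^sup>2 * c"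
      using symB[of v d] unfolding c_def power2_norm_eq_inner
      by (simp add: matrix_vector_right_distrib matrix_vector_mult_scaleR algebra_simps power2_eq_square inner_commute)
    also have "?q v - \<mu> * (v \<bullet> v) = 0" using v(2) by (simp add: \<mu>_def norm_eq_1)
    also have "d \<bullet> (B *v v) - \<mu> * (d \<bullet> v) = - a"
      unfolding a_def power2_norm_eq_inner by (subst (4) d_def) (simp add: inner_diff_right)
    finally have "2 * t * a \<le> t\<^sup>2 * c" by simp
    then have "2 * a \<le> t * c" using t by (simp add: power2_eq_square)
    also have "t * c \<le> a" using \<open>a > 0\<close> c by (simp add: t_def field_simps)
    finally show False using \<open>a > 0\<close> by simp
  qed
  then have "B *v v = \<mu> *\<^sub>R v" by (simp add: d_def)
  from that[OF v this bound] show ?thesis .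
qed

text \<open>The square of the least eigenvalue of \<open>B\<close> on \<open>E\<close> is an
  eigenvalue of \<open>transpose B ** B\<close> there, so the least singular value is at most that
  eigenvalue. Conversely, positivity of \<open>B - c *\<^sub>R mat 1\<close> and Cauchy-Schwarz give
  \<open>c * norm v < norm (B *v v)\<close>, and for an eigenvector of
  \<open>transpose B ** B\<close> the right side is its singular value times
  \<open>norm v\<close>.\<close>

lemma sigma_min_on_bounds:
  fixes B :: "real^'n^'n"
  assumes sym: "transpose B = B" and E: "subspace E" "E \<noteq> {0}" and BE: "\<And>v. v \<in> E \<Longrightarrow> B *v v \<in> E"
    and pd: "pos_def_on E B"
  shows "v \<in> E \<Longrightarrow> sigma_min_on E B * (norm v)\<^sup>2 \<le> v \<bullet> (B *v v)"
    and "0 \<le> c \<Longrightarrow> pos_def_on E (B - c *\<^sub>R mat 1) \<Longrightarrow> c < sigma_min_on E B"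
proof -
  let ?S = "{\<mu>. \<exists>v\<in>E. v \<noteq> 0 \<and> (transpose B ** B) *v v = \<mu> *\<^sub>R v}"
  have sm: "sigma_min_on E B = Min (sqrt ` ?S)"
    unfolding sigma_min_on_def by (rule arg_cong[of _ _ Min]) auto
  have "finite ?S"
    by (rule finite_eigenvalues_on) (simp add: matrix_transpose_mul)
  then have fin: "finite (sqrt ` ?S)" by simp
  obtain e \<mu> where e: "e \<in> E" "norm e = 1" "B *v e = \<mu> *\<^sub>R e"
    and bound: "\<And>w. w \<in> E \<Longrightarrow> \<mu> * (norm w)\<^sup>2 \<le> w \<bullet> (B *v w)"
    using minimal_eigenvector[OF sym E BE] by metis
  have "e \<noteq> 0" using e(2) by auto
  then have "0 < \<mu>" using pd e by (auto simp: pos_def_on_def norm_eq_1)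
  have "(transpose B ** B) *v e = \<mu>\<^sup>2 *\<^sub>R e"
    using e(3) by (simp add: sym matrix_vector_mult_scaleR power2_eq_square flip: matrix_vector_mul_assoc)
  then have "\<mu>\<^sup>2 \<in> ?S" using e(1) \<open>e \<noteq> 0\<close> by blast
  then have "sqrt (\<mu>\<^sup>2) \<in> sqrt ` ?S" by (rule imageI)
  then have mem: "\<mu> \<in> sqrt ` ?S" using \<open>0 < \<mu>\<close> by simp
  show "sigma_min_on E B * (norm v)\<^sup>2 \<le> v \<bullet> (B *v v)" if "v \<in> E"
  proof -
    have "sigma_min_on E B * (norm v)\<^sup>2 \<le> \<mu> * (norm v)\<^sup>2"
      unfolding sm using Min_le[OF fin mem] by (intro mult_right_mono) auto
    with bound[OF that] show ?thesis by simp
  qed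
  show "c < sigma_min_on E B" if c: "0 \<le> c" and pdc: "pos_def_on E (B - c *\<^sub>R mat 1)"
  proof -
    have "c < sqrt \<nu>" if "\<nu> \<in> ?S" for \<nu>
    proof -
      obtain v where v: "v \<in> E" "v \<noteq> 0" and ev: "(transpose B ** B) *v v = \<nu> *\<^sub>R v"
        using \<open>\<nu> \<in> ?S\<close> by blast
      have "0 < v \<bullet> ((B - c *\<^sub>R mat 1) *v v)" using pdc v by (simp add: pos_def_on_def)
      also have "\<dots> = v \<bullet> (B *v v) - c * (v \<bullet> v)"
        by (simp add: matrix_vector_mult_diff_rdistrib inner_diff_right flip: scaleR_matrix_vector_assoc)
      finally have "c * (norm v)\<^sup>2 < v \<bullet> (B *v v)" by (simp add: power2_norm_eq_inner)
      also have "\<dots> \<le> norm v * norm (B *v v)" by (rule norm_cauchy_schwarz)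
      finally have "c * norm v < norm (B *v v)" using v by (simp add: power2_eq_square)
      then have "(c * norm v)\<^sup>2 < (norm (B *v v))\<^sup>2" using c by (intro power_strict_mono) auto
      also have "\<dots> = v \<bullet> ((transpose B ** B) *v v)"
        unfolding power2_norm_eq_inner
        by (metis dot_lmul_matrix matrix_vector_mul_assoc transpose_matrix_vector transpose_transpose)
      also have "\<dots> = \<nu> * (norm v)\<^sup>2" by (simp add: ev power2_norm_eq_inner)
      finally have "c\<^sup>2 < \<nu>" using v by (simp add: power_mult_distrib)
      then show ?thesis using c by (simp add: real_less_rsqrt)
    qed
    then show ?thesis unfolding sm using fin mem by (subst Min_gr_iff) auto
  qed
qed

lemma norm_add_sq: "(norm (u + v))\<^sup>2 = (norm u)\<^sup>2 + 2 * (u \<bullet> v) + (norm v)\<^sup>2"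
  unfolding power2_norm_eq_inner by (simp add: inner_add_left inner_add_right inner_commute)

lemma spectral_norm_bound: "norm (B *v v) \<le> spectral_norm B * norm v" for B :: "real^'a^'b"
  unfolding spectral_norm_def by (rule onorm) (rule matrix_vector_mul_bounded_linear)

lemma spectral_norm_nonneg: "0 \<le> spectral_norm B" for B :: "real^'a^'b"
  unfolding spectral_norm_def by (rule onorm_pos_le) (rule matrix_vector_mul_bounded_linear)

section \<open>The proximal gradient ADMM\<close>

declare transpose_matrix_vector [simp del]

locale prox_grad_admm =
  fixes P :: "('d::finite, 'm::finite) problem" and L \<beta> \<gamma> :: real
    and H :: "nat \<Rightarrow> real^('d + 'm)^('d + 'm)"
    and x :: "nat \<Rightarrow> real^('d + 'm)" and l :: "nat \<Rightarrow> real^'m"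
  assumes admissible: "admissible_problem P L" and algorithm: "algorithm2 P \<beta> \<gamma> H x l"
begin

abbreviation "N \<equiv> nblocks P"
abbreviation "gradf \<equiv> grad (obj P)"
abbreviation At :: "real^'m \<Rightarrow> real^('d + 'm)" where "At v \<equiv> transpose (cmat P) *v v"
abbreviation "mid i k \<equiv> mixed_point P i (x (Suc k)) (x k)"
abbreviation "dx k \<equiv> x (Suc k) - x k"
abbreviation "\<sigma> i \<equiv> sigma_min_on (block_space P i) (H i)"

definition step_sq :: "nat \<Rightarrow> real" where
  "step_sq k = (\<Sum>i\<in>{1..<N}. (norm (block P i (dx k)))\<^sup>2)"

definition last_sq :: "nat \<Rightarrow> real" where
  "last_sq k = (norm (block P N (dx k)))\<^sup>2"

text \<open>Since the potential involves the previous iterate, \<open>potential k\<close> belongs to the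
  iterate with index \<open>k + 1\<close>.\<close>

definition potential :: "nat \<Rightarrow> real" where
  "potential k = Psi_G P L \<beta> \<gamma> (x (Suc k)) (l (Suc k)) (block P N (x k))"

lemma label_range: "range (label P) = {1..<N}"
  and cmat_last: "\<forall>r s. cmat P $ r $ Inr s = (if r = s then 1 else 0)"
  and L_pos: "0 < L"
  and obj_differentiable: "obj P differentiable (at y)"
  and grad_lipschitz: "L-lipschitz_on UNIV gradf"
  and bdd_obj: "bdd_below (obj P ` obj_domain P)"
  using admissible by (auto simp: admissible_problem_def)

lemma block_assms:
  assumes "i \<in> {1..<N}"
  shows "convex_on (block_space P i) (reg P i)"
    and "\<And>u. u \<in> block_space P i \<Longrightarrow> \<exists>e>0. \<exists>C. C-lipschitz_on (cball u e \<inter> block_space P i) (reg P i)"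
    and "mfd P i \<subseteq> block_space P i" and "bdd_below (reg P i ` feasible_block P i)"
  using admissible assms unfolding admissible_problem_def by auto

lemma H_assms:
  assumes "i \<in> {1..<N}"
  shows "block_matrix P i (H i)" "transpose (H i) = H i" "pos_def_on (block_space P i) (H i)"
  using algorithm assms unfolding algorithm2_def by blast+

lemma beta_pos: "0 < \<beta>" and gamma_pos: "0 < \<gamma>"
  using algorithm by (auto simp: algorithm2_def)

lemma subproblem:
  assumes "i \<in> {1..<N}"
  shows "is_arg_min
    (\<lambda>u. lin_aug_lagrangian P \<beta> i u (mid i k) (l k)
       + 1 / 2 * ((u - block P i (x k)) \<bullet> (H i *v (u - block P i (x k)))))
    (\<lambda>u. u \<in> feasible_block P i) (block P i (x (Suc k)))"
  using algorithm assms unfolding algorithm2_def by blast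

lemma last_step:
  "block P N (x (Suc k)) = block P N (x k)
     - \<gamma> *\<^sub>R partial_grad P N (\<lambda>z. aug_lagrangian P \<beta> z (l k)) (mid N k)"
  and dual_step: "l (Suc k) = l k - \<beta> *\<^sub>R residual P (x (Suc k))"
  using algorithm unfolding algorithm2_def by blast+

lemma feasible:
  assumes "i \<in> {1..<N}"
  shows "block P i (x k) \<in> feasible_block P i"
proof (cases k)
  case 0
  then show ?thesis using algorithm assms unfolding algorithm2_def by blast
next
  case (Suc j)
  then show ?thesis using subproblem[OF assms, of j] by (simp add: is_arg_min_def)
qed

lemma N_ge_2: "2 \<le> N"
proof -
  have "label P undefined \<in> {1..<N}" using label_range by blast
  then show ?thesis by simp
qed

lemma block_of_le: "block_of P c \<le> N"
proof (cases c)
  case (Inl j)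
  have "label P j \<in> {1..<N}" using label_range by blast
  then show ?thesis by (simp add: Inl block_of_def)
qed (simp add: block_of_def)

lemma sum_blocks: "(\<Sum>i\<in>{1..N}. f i) = (\<Sum>i\<in>{1..<N}. f i) + f N" for f :: "nat \<Rightarrow> 'b::comm_monoid_add"
proof -
  have "{1..N} = insert N {1..<N}" using N_ge_2 by auto
  then show ?thesis by (simp add: add.commute)
qed

lemma step_total: "step_sq k + last_sq k = (norm (dx k))\<^sup>2"
  using block_decomposition(1)[OF label_range, of "dx k"]
  unfolding sum_blocks step_sq_def last_sq_def .

lemma norm_grad_diff_le: "norm (gradf u - gradf v) \<le> L * norm (u - v)"
  using lipschitz_onD[OF grad_lipschitz] by (simp add: dist_norm)

lemma mid_first: "mid 1 k = x k"
proof -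
  have "\<not> block_of P c < 1" for c
  proof (cases c)
    case (Inl j)
    have "label P j \<in> {1..<N}" using label_range by blast
    then show ?thesis by (simp add: Inl block_of_def)
  qed (use N_ge_2 in \<open>simp add: block_of_def\<close>)
  then show ?thesis by (simp only: mixed_point_def vec_eq_iff vec_lambda_beta if_False simp_thms)
qed

lemma mid_last: "mid (Suc N) k = x (Suc k)"
  using block_of_le by (simp add: mixed_point_def vec_eq_iff less_Suc_eq_le)

lemma new_eq_mid: "x (Suc k) = mid N k + block P N (dx k)"
  using mid_last mixed_point_Suc by metis

text \<open>Solving subproblem \<open>i\<close> moves the Gauss-Seidel point from
  \<open>mid i k\<close> to \<open>mid (Suc i) k\<close>, so the estimates for the single blocks can
  be chained.\<close>

lemma replace_block_mid:
  "replace_block P i (mid i k) (block P i (x (Suc k))) = mid (Suc i) k"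
  "replace_block P i (mid i k) (block P i (x k)) = mid i k"
  by (simp_all add: replace_block_eq block_diff block_block block_mixed_point mixed_point_Suc)

section \<open>The last block as an isometric copy of the multiplier space\<close>

lemma cmat_last_transpose: "cmat P *v block P N (At v) = v"
proof -
  have "cmat P *v block P N (block P N (At v)) = v"
    unfolding block_last_transpose(2)[OF label_range cmat_last]
    unfolding block_last_transpose(1)[OF label_range cmat_last] by (simp add: vec_eq_iff)
  then show ?thesis by (simp add: block_block)
qed

lemma transpose_cmat_last: "block P N (At (cmat P *v block P N y)) = block P N y"
proof -
  have "block_of P (Inl j) \<noteq> N" for j
  proof -
    have "label P j \<in> {1..<N}" using label_range by blast
    then show ?thesis by (simp add: block_of_def)
  qed
  then show ?thesis
    unfolding block_last_transpose[OF label_range cmat_last]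
    by (auto simp: vec_eq_iff block_def block_of_def split: sum.split)
qed

lemma norm_cmat_last: "norm (cmat P *v block P N y) = norm (block P N y)"
proof -
  have "(norm (cmat P *v block P N y))\<^sup>2 = block P N (At (cmat P *v block P N y)) \<bullet> y"
    by (simp only: inner_block_transpose power2_norm_eq_inner)
  also have "\<dots> = (norm (block P N y))\<^sup>2"
    unfolding transpose_cmat_last power2_norm_eq_inner inner_block_block ..
  finally show ?thesis by simp
qed

lemma norm_transpose_last: "norm (block P N (At v)) = norm v"
  using norm_cmat_last[of "At v"] by (simp add: cmat_last_transpose)

subsection \<open>The augmented Lagrangian along the iteration\<close>

text \<open>The constraint part of the augmented Lagrangian. The linearized model keeps it
  unchanged, so passing to the model costs only the linearization error of the objective.\<close>

definition penalty :: "real^('d + 'm) \<Rightarrow> real^'m \<Rightarrow> real" where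
  "penalty y v = - residual P y \<bullet> v + \<beta> / 2 * (norm (residual P y))\<^sup>2"

lemma aug_lagrangian_penalty:
  "aug_lagrangian P \<beta> y v = obj P y + (\<Sum>i\<in>{1..<N}. reg P i (block P i y)) + penalty y v"
  by (simp add: aug_lagrangian_def penalty_def)

lemma penalty_add:
  "penalty (y + d) v = penalty y v + (\<beta> *\<^sub>R residual P y - v) \<bullet> (cmat P *v d) + \<beta> / 2 * (norm (cmat P *v d))\<^sup>2"
proof -
  show ?thesis
    unfolding penalty_def residual_add norm_add_sq
    by (simp add: inner_add_left inner_diff_left inner_commute[of v] distrib_left)
qed

lemma has_derivative_residual: "((\<lambda>z. residual P z) has_derivative (\<lambda>h. cmat P *v h)) (at y)"
  unfolding residual_def
  by (auto intro!: derivative_eq_intros bounded_linear_imp_has_derivative matrix_vector_mul_bounded_linear)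

lemma has_derivative_penalty:
  "((\<lambda>z. penalty z v) has_derivative (\<lambda>h. (\<beta> *\<^sub>R residual P y - v) \<bullet> (cmat P *v h))) (at y)"
proof -
  have "((\<lambda>z. (- residual P z) \<bullet> v + \<beta> / 2 * (residual P z \<bullet> residual P z)) has_derivative
      (\<lambda>h. (- (cmat P *v h)) \<bullet> v + \<beta> / 2 * (residual P y \<bullet> (cmat P *v h) + (cmat P *v h) \<bullet> residual P y))) (at y)"
    by (intro has_derivative_add has_derivative_inner_left has_derivative_minus has_derivative_mult_right
        has_derivative_inner has_derivative_residual)
  moreover have "(- (cmat P *v h)) \<bullet> v + \<beta> / 2 * (residual P y \<bullet> (cmat P *v h) + (cmat P *v h) \<bullet> residual P y)
      = (\<beta> *\<^sub>R residual P y - v) \<bullet> (cmat P *v h)" for h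
    by (simp add: inner_diff_left inner_commute[of "cmat P *v h"])
  ultimately show ?thesis
    unfolding penalty_def power2_norm_eq_inner by (simp only:)
qed

lemma GDERIV_penalty: "GDERIV (\<lambda>z. penalty z v) y :> At (\<beta> *\<^sub>R residual P y - v)"
proof -
  have "(\<lambda>h. (\<beta> *\<^sub>R residual P y - v) \<bullet> (cmat P *v h)) = (\<lambda>h. h \<bullet> At (\<beta> *\<^sub>R residual P y - v))"
    by (rule ext) (metis dot_lmul_matrix inner_commute transpose_matrix_vector)
  then show ?thesis
    using has_derivative_penalty[of v y] by (simp only: gderiv_def)
qed

lemma partial_grad_obj: "partial_grad P i (obj P) y = block P i (gradf y)"
  by (rule partial_grad_eq[OF GDERIV_grad[OF obj_differentiable]])

lemma partial_grad_aug_lagrangian: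
  "partial_grad P N (\<lambda>z. aug_lagrangian P \<beta> z v) y = block P N (gradf y + At (\<beta> *\<^sub>R residual P y - v))"
proof -
  \<comment> \<open>The regularizers do not see the last block, so they are constant here and need
    no derivative.\<close>
  define c where "c = (\<Sum>i\<in>{1..<N}. reg P i (block P i y))"
  have "aug_lagrangian P \<beta> (replace_block P N y z) v =
      obj P (replace_block P N y z) + c + penalty (replace_block P N y z) v" for z
    by (simp add: aug_lagrangian_penalty block_replace_block c_def)
  then have "partial_grad P N (\<lambda>z. aug_lagrangian P \<beta> z v) y =
      partial_grad P N (\<lambda>z. obj P z + c + penalty z v) y"
    by (simp add: partial_grad_def)
  also have "\<dots> = block P N (gradf y + 0 + At (\<beta> *\<^sub>R residual P y - v))"
    by (intro partial_grad_eq GDERIV_add GDERIV_const GDERIV_penalty GDERIV_grad obj_differentiable)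
  finally show ?thesis by simp
qed

section \<open>The multiplier identity and the change of the multiplier\<close>

lemma last_step':
  "block P N (dx k) = - \<gamma> *\<^sub>R block P N (gradf (mid N k) + At (\<beta> *\<^sub>R residual P (mid N k) - l k))"
  using last_step[of k] unfolding partial_grad_aug_lagrangian by (simp add: block_diff)

lemma residual_new: "residual P (x (Suc k)) = residual P (mid N k) + cmat P *v block P N (dx k)"
  by (subst new_eq_mid) (rule residual_add)

text \<open>The gradient step expresses the old multiplier through the residual before the last
  block moves, and the dual step uses the residual after it. Since the last matrix is the identity,
  the two differ by the last step itself, so the residual cancels.\<close>

lemma transpose_dual:
  "block P N (At (l (Suc k))) = block P N (gradf (mid N k)) - (\<beta> - 1 / \<gamma>) *\<^sub>R block P N (dx k)"
proof -
  let ?d = "block P N (dx k)" and ?r = "residual P (mid N k)"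
  let ?B = "\<lambda>v. block P N (At v)"
  have B: "?B (u + v) = ?B u + ?B v" "?B (u - v) = ?B u - ?B v" "?B (c *\<^sub>R v) = c *\<^sub>R ?B v" for u v c
    by (simp_all add: matrix_vector_right_distrib matrix_vector_mult_diff_distrib
        matrix_vector_mult_scaleR block_add block_diff block_scaleR)
  have "?d /\<^sub>R \<gamma> = - (block P N (gradf (mid N k)) + \<beta> *\<^sub>R ?B ?r - ?B (l k))"
    using gamma_pos by (subst last_step') (simp add: block_add B)
  then have "?B (l k) = block P N (gradf (mid N k)) + \<beta> *\<^sub>R ?B ?r + ?d /\<^sub>R \<gamma>"
    by (simp only:) simp
  moreover have "?B (l (Suc k)) = ?B (l k) - \<beta> *\<^sub>R (?B ?r + ?d)"
    unfolding dual_step residual_new B transpose_cmat_last ..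
  ultimately show ?thesis by (simp add: algebra_simps divide_inverse)
qed

text \<open>Two consecutive identities are subtracted. Their gradients are taken at points whose
  last block is one iteration older than the others; hence \<open>L\<^sup>2\<close> multiplies
  \<open>last_sq k\<close> but \<open>step_sq (Suc k)\<close>. The factor 3 comes from (a + b + e)^2
  \<le> 3 (a^2 + b^2 + e^2).\<close>

lemma dual_change_bound:
  "(norm (l (Suc (Suc k)) - l (Suc k)))\<^sup>2 \<le>
     3 * (\<beta> - 1 / \<gamma>)\<^sup>2 * last_sq (Suc k) + 3 * ((\<beta> - 1 / \<gamma>)\<^sup>2 + L\<^sup>2) * last_sq k + 3 * L\<^sup>2 * step_sq (Suc k)"
proof -
  let ?c = "\<beta> - 1 / \<gamma>"
  let ?m = "mid N (Suc k) - mid N k"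
  define a b e where "a = L * norm ?m" and "b = \<bar>?c\<bar> * norm (block P N (dx (Suc k)))"
    and "e = \<bar>?c\<bar> * norm (block P N (dx k))"
  have "norm (l (Suc (Suc k)) - l (Suc k)) = norm (block P N (At (l (Suc (Suc k)))) - block P N (At (l (Suc k))))"
    unfolding norm_transpose_last[symmetric, of "l (Suc (Suc k)) - l (Suc k)"]
    by (simp add: matrix_vector_mult_diff_distrib block_diff)
  also have "\<dots> = norm (block P N (gradf (mid N (Suc k)) - gradf (mid N k)) - ?c *\<^sub>R block P N (dx (Suc k)) + ?c *\<^sub>R block P N (dx k))"
    unfolding transpose_dual block_diff by (simp add: algebra_simps)
  also have "\<dots> \<le> norm (block P N (gradf (mid N (Suc k)) - gradf (mid N k))) + b + e"
    unfolding b_def e_def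
    by (intro order.trans[OF norm_triangle_ineq] add_right_mono order.trans[OF norm_triangle_ineq4] add_mono) auto
  also have "\<dots> \<le> a + b + e"
    unfolding a_def by (intro add_right_mono order.trans[OF norm_block_le] norm_grad_diff_le)
  finally have "(norm (l (Suc (Suc k)) - l (Suc k)))\<^sup>2 \<le> (a + b + e)\<^sup>2"
    by (intro power_mono) auto
  also have "\<dots> \<le> 3 * (a\<^sup>2 + b\<^sup>2 + e\<^sup>2)"
    using sum_squares_ge_zero[of "a - b" "b - e"] zero_le_power2[of "a - e"]
    by (simp add: power2_eq_square algebra_simps)
  also have "a\<^sup>2 = L\<^sup>2 * (step_sq (Suc k) + last_sq k)"
  proof -
    have "(norm ?m)\<^sup>2 = (\<Sum>i\<in>{1..<N}. (norm (block P i ?m))\<^sup>2) + (norm (block P N ?m))\<^sup>2"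
      using block_decomposition(1)[OF label_range, of ?m] unfolding sum_blocks by (rule sym)
    also have "\<dots> = step_sq (Suc k) + last_sq k"
      by (simp add: step_sq_def last_sq_def block_diff block_mixed_point)
    finally show ?thesis by (simp add: a_def power_mult_distrib)
  qed
  also have "b\<^sup>2 = ?c\<^sup>2 * last_sq (Suc k)" by (simp add: b_def last_sq_def power_mult_distrib)
  also have "e\<^sup>2 = ?c\<^sup>2 * last_sq k" by (simp add: e_def last_sq_def power_mult_distrib)
  finally show ?thesis by (simp add: algebra_simps)
qed

section \<open>Descent and lower bound of the potential\<close>

lemma lin_aug_lagrangian_penalty:
  "lin_aug_lagrangian P \<beta> i u y v =
     obj P y + block P i (gradf y) \<bullet> (u - block P i y) + reg P i u + penalty (replace_block P i y u) v"
  by (simp add: lin_aug_lagrangian_def penalty_def partial_grad_obj)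

lemma block_H:
  assumes "i \<in> {1..<N}"
  shows "H i *v v \<in> block_space P i"
  using H_assms(1)[OF assms] by (auto simp: block_matrix_def block_space_def matrix_vector_mult_def intro!: sum.neutral)

lemma block_space_nontrivial:
  assumes "i \<in> {1..<N}"
  shows "block_space P i \<noteq> {0}"
proof -
  obtain j where "label P j = i" using assms label_range by (metis imageE)
  then have "axis (Inl j) 1 \<in> block_space P i" by (auto simp: block_space_def axis_def block_of_def)
  moreover have "axis (Inl j) (1::real) \<noteq> (0 :: real^('d + 'm))" by (simp add: axis_eq_0_iff)
  ultimately show ?thesis by blast
qed

lemmas sigma_bounds = sigma_min_on_bounds[OF H_assms(2) subspace_block_space block_space_nontrivial block_H H_assms(3)]

text \<open>The old block is feasible for the subproblem. Returning from the linear model to the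
  objective costs L/2 and the proximal term earns half of \<open>\<sigma> i\<close>, both times the
  squared step.\<close>

lemma block_descent:
  assumes i: "i \<in> {1..<N}"
  shows "aug_lagrangian P \<beta> (mid (Suc i) k) (l k) \<le>
    aug_lagrangian P \<beta> (mid i k) (l k) + (L / 2 - \<sigma> i / 2) * (norm (block P i (dx k)))\<^sup>2"
proof -
  let ?d = "block P i (dx k)" and ?m = "mid i k"
  have bm: "block P i ?m = block P i (x k)" by (simp add: block_mixed_point)
  have "lin_aug_lagrangian P \<beta> i (block P i (x (Suc k))) ?m (l k) + 1 / 2 * (?d \<bullet> (H i *v ?d))
      \<le> lin_aug_lagrangian P \<beta> i (block P i (x k)) ?m (l k)"
    using subproblem[OF i, of k] feasible[OF i, of k]
    by (fastforce simp: is_arg_min_def not_less block_diff)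
  then have "block P i (gradf ?m) \<bullet> ?d + reg P i (block P i (x (Suc k))) + penalty (mid (Suc i) k) (l k)
      + 1 / 2 * (?d \<bullet> (H i *v ?d)) \<le> reg P i (block P i (x k)) + penalty ?m (l k)"
    unfolding lin_aug_lagrangian_penalty replace_block_mid bm by (simp add: block_diff)
  moreover have "obj P (mid (Suc i) k) \<le> obj P ?m + gradf ?m \<bullet> ?d + L / 2 * (norm ?d)\<^sup>2"
    unfolding mixed_point_Suc by (rule Lipschitz_gradient_upper_bound[OF obj_differentiable grad_lipschitz])
  moreover have "block P i (gradf ?m) \<bullet> ?d = gradf ?m \<bullet> ?d"
    by (simp add: inner_block_left block_block)
  moreover have "\<sigma> i * (norm ?d)\<^sup>2 \<le> ?d \<bullet> (H i *v ?d)"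
    by (rule sigma_bounds(1)[OF i i i i block_in_block_space])
  moreover have "(\<Sum>j\<in>{1..<N}. reg P j (block P j (mid (Suc i) k))) - (\<Sum>j\<in>{1..<N}. reg P j (block P j ?m))
      = reg P i (block P i (x (Suc k))) - reg P i (block P i (x k))"
  proof -
    have "reg P j (block P j (mid (Suc i) k)) - reg P j (block P j ?m) =
        (if j = i then reg P i (block P i (x (Suc k))) - reg P i (block P i (x k)) else 0)" for j
      by (auto simp: block_mixed_point less_Suc_eq)
    then show ?thesis using i by (simp flip: sum_subtractf)
  qed
  ultimately show ?thesis
    unfolding aug_lagrangian_penalty by (simp add: algebra_simps)
qed

lemma blocks_descent:
  "aug_lagrangian P \<beta> (mid N k) (l k) \<le>
    aug_lagrangian P \<beta> (x k) (l k) + (\<Sum>i\<in>{1..<N}. (L / 2 - \<sigma> i / 2) * (norm (block P i (dx k)))\<^sup>2)"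
proof -
  have "aug_lagrangian P \<beta> (mid (Suc n) k) (l k) \<le>
    aug_lagrangian P \<beta> (x k) (l k) + (\<Sum>i\<in>{1..<Suc n}. (L / 2 - \<sigma> i / 2) * (norm (block P i (dx k)))\<^sup>2)"
    if "Suc n \<le> N" for n
    using that
  proof (induction n)
    case 0
    then show ?case using mid_first by simp
  next
    case (Suc n)
    with block_descent[of "Suc n" k] show ?case by simp
  qed
  from this[of "N - 1"] show ?thesis using N_ge_2 by simp
qed

text \<open>In the last block the objective has curvature at most \<open>L\<close>, and the penalty
  exactly \<open>\<beta>\<close> because the last matrix is an isometry. The gradient step makes the
  first-order term equal to - 1/\<gamma> times the squared step.\<close>

lemma last_descent:
  "aug_lagrangian P \<beta> (x (Suc k)) (l k) \<le>
    aug_lagrangian P \<beta> (mid N k) (l k) + ((\<beta> + L) / 2 - 1 / \<gamma>) * last_sq k"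
proof -
  let ?d = "block P N (dx k)" and ?m = "mid N k"
  let ?G = "gradf ?m + At (\<beta> *\<^sub>R residual P ?m - l k)"
  have "obj P (x (Suc k)) \<le> obj P ?m + gradf ?m \<bullet> ?d + L / 2 * (norm ?d)\<^sup>2"
    by (subst new_eq_mid) (rule Lipschitz_gradient_upper_bound[OF obj_differentiable grad_lipschitz])
  moreover have "penalty (x (Suc k)) (l k) = penalty ?m (l k) + At (\<beta> *\<^sub>R residual P ?m - l k) \<bullet> ?d + \<beta> / 2 * (norm ?d)\<^sup>2"
    by (subst new_eq_mid, subst penalty_add) (simp only: norm_cmat_last dot_lmul_matrix transpose_matrix_vector)
  moreover have "?G \<bullet> ?d = - (1 / \<gamma>) * (norm ?d)\<^sup>2"
  proof -
    have "?G \<bullet> ?d = block P N ?G \<bullet> ?d" by (simp add: inner_block_left block_block)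
    also have "block P N ?G = - (1 / \<gamma>) *\<^sub>R ?d"
      using gamma_pos by (subst last_step') simp
    finally show ?thesis by (simp add: power2_norm_eq_inner)
  qed
  moreover have "block P j (x (Suc k)) = block P j ?m" if "j \<in> {1..<N}" for j
    using that by (simp add: block_mixed_point)
  ultimately show ?thesis
    unfolding aug_lagrangian_penalty last_sq_def by (simp add: inner_add_left algebra_simps add_divide_distrib)
qed

text \<open>The multiplier update is the only part of an iteration that raises the augmented
  Lagrangian; the potential is built to compensate this increase.\<close>

lemma dual_ascent:
  "aug_lagrangian P \<beta> (x (Suc k)) (l (Suc k)) =
    aug_lagrangian P \<beta> (x (Suc k)) (l k) + 1 / \<beta> * (norm (l (Suc k) - l k))\<^sup>2"
proof -
  let ?r = "residual P (x (Suc k))"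
  have "(norm (l (Suc k) - l k))\<^sup>2 = \<beta>\<^sup>2 * (norm ?r)\<^sup>2"
    by (simp add: dual_step power_mult_distrib)
  moreover have "l (Suc k) = l k - \<beta> *\<^sub>R ?r" by (rule dual_step)
  then have "penalty (x (Suc k)) (l (Suc k)) = penalty (x (Suc k)) (l k) + \<beta> * (norm ?r)\<^sup>2"
    unfolding penalty_def power2_norm_eq_inner by (simp only: inner_diff_right) simp
  ultimately show ?thesis
    using beta_pos unfolding aug_lagrangian_penalty by (simp add: power2_eq_square)
qed

lemma potential_eq:
  "potential k = aug_lagrangian P \<beta> (x (Suc k)) (l (Suc k)) + 3 / \<beta> * ((\<beta> - 1 / \<gamma>)\<^sup>2 + L\<^sup>2) * last_sq k"
  by (simp add: potential_def Psi_G_def last_sq_def block_diff norm_minus_commute)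

lemma potential_descent:
  assumes last: "\<tau> \<le> - ((\<beta> + L) / 2 - 1 / \<gamma> + 6 / \<beta> * (\<beta> - 1 / \<gamma>)\<^sup>2 + 3 * L\<^sup>2 / \<beta>)"
    and blocks: "\<And>i. i \<in> {1..<N} \<Longrightarrow> \<tau> \<le> - (3 * L\<^sup>2 / \<beta> + L / 2 - \<sigma> i / 2)"
  shows "potential (Suc k) + \<tau> * (norm (dx (Suc k)))\<^sup>2 \<le> potential k"
proof -
  let ?c = "\<beta> - 1 / \<gamma>" and ?k = "Suc k"
  have "1 / \<beta> * (norm (l (Suc ?k) - l ?k))\<^sup>2 \<le>
      1 / \<beta> * (3 * ?c\<^sup>2 * last_sq ?k + 3 * (?c\<^sup>2 + L\<^sup>2) * last_sq k + 3 * L\<^sup>2 * step_sq ?k)"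
    using beta_pos by (intro mult_left_mono dual_change_bound) auto
  also have "\<dots> = 3 / \<beta> * ?c\<^sup>2 * last_sq ?k + 3 / \<beta> * (?c\<^sup>2 + L\<^sup>2) * last_sq k + 3 * L\<^sup>2 / \<beta> * step_sq ?k"
    using beta_pos by (simp add: field_simps)
  finally have dual: "1 / \<beta> * (norm (l (Suc ?k) - l ?k))\<^sup>2 \<le> \<dots>" .
  have "(\<Sum>i\<in>{1..<N}. (L / 2 - \<sigma> i / 2) * (norm (block P i (dx ?k)))\<^sup>2)
      \<le> (\<Sum>i\<in>{1..<N}. (- \<tau> - 3 * L\<^sup>2 / \<beta>) * (norm (block P i (dx ?k)))\<^sup>2)"
  proof (intro sum_mono mult_right_mono)
    fix i assume "i \<in> {1..<N}"
    from blocks[OF this] show "L / 2 - \<sigma> i / 2 \<le> - \<tau> - 3 * L\<^sup>2 / \<beta>" by simp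
  qed simp
  also have "\<dots> = (- \<tau> - 3 * L\<^sup>2 / \<beta>) * step_sq ?k"
    by (simp add: step_sq_def sum_distrib_left)
  finally have blk: "(\<Sum>i\<in>{1..<N}. (L / 2 - \<sigma> i / 2) * (norm (block P i (dx ?k)))\<^sup>2) \<le> \<dots>" .
  have "\<tau> * last_sq ?k \<le> - ((\<beta> + L) / 2 - 1 / \<gamma> + 6 / \<beta> * ?c\<^sup>2 + 3 * L\<^sup>2 / \<beta>) * last_sq ?k"
    using last by (intro mult_right_mono) (auto simp: last_sq_def)
  \<comment> \<open>The coefficient splits into one share for the current last-block step in the
    dual change and one share for the extra term that reappears in
    \<open>potential (Suc k)\<close>.\<close>
  also have "\<dots> = - ((\<beta> + L) / 2 - 1 / \<gamma>) * last_sq ?k - 3 / \<beta> * ?c\<^sup>2 * last_sq ?k - 3 / \<beta> * (?c\<^sup>2 + L\<^sup>2) * last_sq ?k"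
    by (simp add: algebra_simps)
  finally have lst: "\<tau> * last_sq ?k \<le> \<dots>" .
  show ?thesis
    using dual blk lst blocks_descent[of ?k] last_descent[of ?k] dual_ascent[of ?k]
    unfolding potential_eq step_total[symmetric] by (simp add: algebra_simps)
qed

text \<open>The residual is a multiple of the change of the multiplier, hence the multiplier term of
  the augmented Lagrangian is bounded below by a telescoping sequence.\<close>

lemma aug_lagrangian_lower_bound:
  "(\<Sum>i\<in>{1..<N}. reg_min P i) + obj_min P + ((norm (l (Suc k)))\<^sup>2 - (norm (l k))\<^sup>2) / (2 * \<beta>)
    \<le> aug_lagrangian P \<beta> (x (Suc k)) (l (Suc k))"
proof -
  let ?r = "residual P (x (Suc k))"
  have "obj_min P \<le> obj P (x (Suc k))"
    unfolding obj_min_def by (rule cINF_lower[OF bdd_obj]) (use feasible in \<open>simp add: obj_domain_def\<close>)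
  moreover have "(\<Sum>i\<in>{1..<N}. reg_min P i) \<le> (\<Sum>i\<in>{1..<N}. reg P i (block P i (x (Suc k))))"
    unfolding reg_min_def by (intro sum_mono cINF_lower block_assms feasible)
  moreover have "((norm (l (Suc k)))\<^sup>2 - (norm (l k))\<^sup>2) / (2 * \<beta>) \<le> penalty (x (Suc k)) (l (Suc k))"
  proof -
    have "l k = l (Suc k) + \<beta> *\<^sub>R ?r" by (simp add: dual_step)
    then have "(norm (l k))\<^sup>2 = (norm (l (Suc k)))\<^sup>2 + 2 * \<beta> * (?r \<bullet> l (Suc k)) + \<beta>\<^sup>2 * (norm ?r)\<^sup>2"
      by (simp add: norm_add_sq inner_commute power_mult_distrib)
    then have "((norm (l (Suc k)))\<^sup>2 - (norm (l k))\<^sup>2) / (2 * \<beta>) = - (?r \<bullet> l (Suc k)) - \<beta> / 2 * (norm ?r)\<^sup>2"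
      using beta_pos by (simp add: field_simps power2_eq_square)
    \<comment> \<open>The two sides differ by \<open>\<beta> * (norm ?r)\<^sup>2\<close>.\<close>
    also have "\<dots> \<le> penalty (x (Suc k)) (l (Suc k))"
      unfolding penalty_def using beta_pos by simp
    finally show ?thesis .
  qed
  ultimately show ?thesis unfolding aug_lagrangian_penalty by simp
qed

text \<open>No bound on the multipliers is assumed. If the potential ever fell below the claimed
  bound by \<delta>, it would stay that low, and each further iteration would lower
  \<open>(norm (l k))\<^sup>2 / (2 * \<beta>)\<close> by at least \<delta>, eventually below
  zero.\<close>

lemma potential_lower_bound:
  assumes desc: "\<And>k. potential (Suc k) \<le> potential k"
  shows "(\<Sum>i\<in>{1..<N}. reg_min P i) + obj_min P \<le> potential j"
proof (rule ccontr)
  let ?m = "(\<Sum>i\<in>{1..<N}. reg_min P i) + obj_min P"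
  assume "\<not> ?m \<le> potential j"
  define \<delta> where "\<delta> = ?m - potential j"
  have \<delta>: "\<delta> > 0" using \<open>\<not> ?m \<le> potential j\<close> by (simp add: \<delta>_def)
  have ge: "?m + ((norm (l (Suc k)))\<^sup>2 - (norm (l k))\<^sup>2) / (2 * \<beta>) \<le> potential k" for k
  proof -
    have "0 \<le> 3 / \<beta> * ((\<beta> - 1 / \<gamma>)\<^sup>2 + L\<^sup>2) * last_sq k"
      using beta_pos by (simp add: last_sq_def)
    with aug_lagrangian_lower_bound[of k] show ?thesis unfolding potential_eq by linarith
  qed
  have "decseq potential" using desc by (simp add: decseq_Suc_iff)
  then have le: "potential (j + n) \<le> potential j" for n by (simp add: decseq_def)
  have bound: "(norm (l (j + n)))\<^sup>2 / (2 * \<beta>) \<le> (norm (l j))\<^sup>2 / (2 * \<beta>) - n * \<delta>" for n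
  proof (induction n)
    case (Suc n)
    have "((norm (l (j + Suc n)))\<^sup>2 - (norm (l (j + n)))\<^sup>2) / (2 * \<beta>) \<le> - \<delta>"
      using ge[of "j + n"] le[of n] by (simp add: \<delta>_def)
    with Suc show ?case by (simp add: diff_divide_distrib algebra_simps)
  qed simp
  obtain n :: nat where n: "(norm (l j))\<^sup>2 / (2 * \<beta>) < n * \<delta>"
    using reals_Archimedean3[OF \<delta>] by blast
  have "0 \<le> (norm (l (j + n)))\<^sup>2 / (2 * \<beta>)" using beta_pos by simp
  with bound[of n] n show False by linarith
qed

subsection \<open>Stationarity of the iterates\<close>

text \<open>Source of \<open>\<kappa>1\<close>: \<open>\<beta>\<close> times the residual is the
  multiplier change. The coefficients are raised to a common value so that the parts reassemble into
  full step norms.\<close>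

lemma norm_residual_le:
  "(norm (residual P (x (Suc (Suc k)))))\<^sup>2 \<le>
    3 / \<beta>\<^sup>2 * ((\<beta> - 1 / \<gamma>)\<^sup>2 + L\<^sup>2) * ((norm (dx (Suc k)))\<^sup>2 + (norm (dx k))\<^sup>2)"
proof -
  let ?c = "\<beta> - 1 / \<gamma>"
  have nn: "0 \<le> last_sq i" "0 \<le> step_sq i" for i by (auto simp: last_sq_def step_sq_def sum_nonneg)
  have "\<beta>\<^sup>2 * (norm (residual P (x (Suc (Suc k)))))\<^sup>2 = (norm (l (Suc (Suc k)) - l (Suc k)))\<^sup>2"
    unfolding dual_step[of "Suc k"] by (simp add: power_mult_distrib)
  also have "\<dots> \<le> 3 * ?c\<^sup>2 * last_sq (Suc k) + 3 * (?c\<^sup>2 + L\<^sup>2) * last_sq k + 3 * L\<^sup>2 * step_sq (Suc k)"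
    by (rule dual_change_bound)
  also have "\<dots> \<le> 3 * (?c\<^sup>2 + L\<^sup>2) * last_sq (Suc k) + 3 * (?c\<^sup>2 + L\<^sup>2) * (step_sq k + last_sq k) + 3 * (?c\<^sup>2 + L\<^sup>2) * step_sq (Suc k)"
    using nn by (intro add_mono mult_right_mono mult_left_mono) auto
  also have "\<dots> = 3 * (?c\<^sup>2 + L\<^sup>2) * ((norm (dx (Suc k)))\<^sup>2 + (norm (dx k))\<^sup>2)"
    unfolding step_total[symmetric] by (simp add: algebra_simps)
  finally show ?thesis using beta_pos by (simp add: field_simps)
qed

text \<open>Source of \<open>\<kappa>2\<close>: by the multiplier identity, what remains is the
  gradient change caused by the last step and a multiple of that step.\<close>

lemma norm_last_gradient_le:
  "norm (partial_grad P N (obj P) (x (Suc k)) - transpose (col_block P N) *v l (Suc k))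
    \<le> (\<bar>\<beta> - 1 / \<gamma>\<bar> + L) * norm (dx k)"
proof -
  let ?c = "\<beta> - 1 / \<gamma>"
  have "partial_grad P N (obj P) (x (Suc k)) - transpose (col_block P N) *v l (Suc k) =
      block P N (gradf (x (Suc k)) - gradf (mid N k)) + ?c *\<^sub>R block P N (dx k)"
    unfolding partial_grad_obj transpose_col_block_mult transpose_dual by (simp add: block_diff)
  also have "norm \<dots> \<le> L * norm (dx k) + \<bar>?c\<bar> * norm (dx k)"
  proof (intro order.trans[OF norm_triangle_ineq] add_mono)
    have "norm (block P N (gradf (x (Suc k)) - gradf (mid N k))) \<le> L * norm (x (Suc k) - mid N k)"
      by (rule order.trans[OF norm_block_le norm_grad_diff_le])
    also have "\<dots> \<le> L * norm (dx k)"
      using L_pos by (intro mult_left_mono norm_diff_mixed_point_le) auto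
    finally show "norm (block P N (gradf (x (Suc k)) - gradf (mid N k))) \<le> L * norm (dx k)" .
  qed (simp add: mult_left_mono norm_block_le)
  finally show ?thesis by (simp add: algebra_simps)
qed

text \<open>A transpose has no larger operator norm; this is seen by pairing the vector with itself
  and cancelling one factor of its norm.\<close>

lemma norm_block_transpose_le: "norm (block P i (At v)) \<le> spectral_norm (col_block P i) * norm v"
proof -
  let ?y = "block P i (At v)"
  have "norm ?y * norm ?y = v \<bullet> (col_block P i *v ?y)"
    unfolding col_block_mult inner_block_transpose[symmetric] by (simp add: power2_norm_eq_inner flip: power2_eq_square)
  also have "\<dots> \<le> norm v * (spectral_norm (col_block P i) * norm ?y)"
    by (intro order.trans[OF norm_cauchy_schwarz] mult_left_mono spectral_norm_bound) auto
  finally have "norm ?y * norm ?y \<le> (spectral_norm (col_block P i) * norm v) * norm ?y"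
    by (simp add: mult.commute mult.left_commute)
  then show ?thesis
    using spectral_norm_nonneg[of "col_block P i"] by (cases "?y = 0") auto
qed

text \<open>Origin of sqrt N in \<open>\<kappa>3\<close>: Cauchy-Schwarz for the sum of the
  \<open>N\<close> block norms.\<close>

lemma norm_cmat_mult_le:
  assumes s: "\<And>j. j \<in> {1..N} \<Longrightarrow> spectral_norm (col_block P j) \<le> s"
  shows "norm (cmat P *v w) \<le> s * sqrt N * norm w"
proof -
  have s0: "0 \<le> s" using s[of N] spectral_norm_nonneg[of "col_block P N"] N_ge_2 by simp
  have "norm (cmat P *v w) = norm (cmat P *v (\<Sum>j\<in>{1..N}. block P j w))"
    by (simp only: block_decomposition(2)[OF label_range])
  also have "\<dots> = norm (\<Sum>j\<in>{1..N}. col_block P j *v block P j w)"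
    by (simp add: linear_sum[OF matrix_vector_mul_linear] col_block_mult block_block)
  also have "\<dots> \<le> (\<Sum>j\<in>{1..N}. s * norm (block P j w))"
    by (intro sum_norm_le order.trans[OF spectral_norm_bound] mult_right_mono s) auto
  also have "\<dots> = s * (\<Sum>j\<in>{1..N}. norm (block P j w))" by (simp add: sum_distrib_left)
  also have "\<dots> \<le> s * (sqrt N * norm w)"
  proof (intro mult_left_mono s0)
    have "(\<Sum>j\<in>{1..N}. 1 * norm (block P j w))\<^sup>2 \<le> (\<Sum>j\<in>{1..N}. 1\<^sup>2) * (\<Sum>j\<in>{1..N}. (norm (block P j w))\<^sup>2)"
      by (rule Cauchy_Schwarz_ineq_sum)
    also have "\<dots> = (sqrt N * norm w)\<^sup>2"
      unfolding block_decomposition(1)[OF label_range] by (simp add: power_mult_distrib)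
    finally have "(\<Sum>j\<in>{1..N}. norm (block P j w))\<^sup>2 \<le> (sqrt N * norm w)\<^sup>2" by simp
    then show "(\<Sum>j\<in>{1..N}. norm (block P j w)) \<le> sqrt N * norm w"
      by (rule power2_le_imp_le) simp
  qed
  finally show ?thesis by (simp add: mult.assoc)
qed

text \<open>Up to the constant \<open>obj P (mid i k)\<close>, the subproblem is a smooth
  \<open>q\<close> plus the regularizer, and \<open>G\<close> is the gradient of \<open>q\<close> at
  the minimizer. The objective was linearized at \<open>mid i k\<close>, but the penalty is
  evaluated after inserting the new block, hence the residual at
  \<open>mid (Suc i) k\<close>.\<close>

lemma subproblem_stationary:
  assumes i: "i \<in> {1..<N}" and ch: "chart_at (mfd P i) (block P i (x (Suc k))) F U \<psi>"
  defines "G \<equiv> block P i (gradf (mid i k) + At (\<beta> *\<^sub>R residual P (mid (Suc i) k) - l k)) + H i *v block P i (dx k)"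
  shows "\<exists>g\<in>subdifferential_on (block_space P i) (reg P i) (block P i (x (Suc k))).
    closest_point (tangent_space (mfd P i) (block P i (x (Suc k)))) (- G - g)
      \<in> mfd_normal_cone (mfd P i) U \<psi> (feasible_block P i) (block P i (x (Suc k)))"
proof -
  let ?p = "block P i (x (Suc k))" and ?m = "mid i k" and ?E = "block_space P i"
  let ?g = "block P i (gradf ?m)" and ?v = "\<beta> *\<^sub>R residual P (mid (Suc i) k) - l k"
  define w where "w u = u - block P i (x k)" for u
  define q where "q u = ?g \<bullet> w u + penalty (replace_block P i ?m u) (l k) + 1 / 2 * (w u \<bullet> (H i *v w u))" for u
  have bm: "block P i ?m = block P i (x k)" by (simp add: block_mixed_point)
  have wp: "w ?p = block P i (dx k)" by (simp add: w_def block_diff)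
  have obj: "lin_aug_lagrangian P \<beta> i u ?m (l k) + 1 / 2 * ((u - block P i (x k)) \<bullet> (H i *v (u - block P i (x k))))
      = obj P ?m + (q u + reg P i u)" for u
    by (simp add: lin_aug_lagrangian_penalty bm q_def w_def)
  have min: "q ?p + reg P i ?p \<le> q u + reg P i u" if "u \<in> feasible_block P i" for u
    using subproblem[OF i, of k] that unfolding is_arg_min_def obj by (auto simp: not_less)
  have dw: "(w has_derivative (\<lambda>h. h)) (at ?p)"
    unfolding w_def by (auto intro!: derivative_eq_intros)
  have dHw: "((\<lambda>u. H i *v w u) has_derivative (\<lambda>h. H i *v h)) (at ?p)"
    using bounded_linear.has_derivative[OF matrix_vector_mul_bounded_linear dw] .
  have "((\<lambda>u. replace_block P i ?m u) has_derivative block P i) (at ?p)"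
    unfolding replace_block_eq
    by (auto intro!: derivative_eq_intros linear_imp_has_derivative linear_block
      simp: block_diff intro: has_derivative_eq_rhs)
  moreover have "((\<lambda>z. penalty z (l k)) has_derivative (\<lambda>h. ?v \<bullet> (cmat P *v h))) (at (replace_block P i ?m ?p))"
    using has_derivative_penalty by (simp add: replace_block_mid)
  ultimately have dpen: "((\<lambda>u. penalty (replace_block P i ?m u) (l k)) has_derivative (\<lambda>h. ?v \<bullet> (cmat P *v block P i h))) (at ?p)"
    by (rule has_derivative_compose)
  have symH: "w ?p \<bullet> (H i *v h) = h \<bullet> (H i *v w ?p)" for h
    by (metis H_assms(2)[OF i] dot_lmul_matrix inner_commute transpose_matrix_vector)
  have rhs: "?g \<bullet> h + ?v \<bullet> (cmat P *v block P i h) + 1 / 2 * (w ?p \<bullet> (H i *v h) + h \<bullet> (H i *v w ?p)) = h \<bullet> G" for h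
  proof -
    have "?v \<bullet> (cmat P *v block P i h) = h \<bullet> block P i (At ?v)" "?g \<bullet> h = h \<bullet> ?g"
      by (metis inner_block_transpose inner_commute) (rule inner_commute)
    then show ?thesis unfolding symH by (simp add: G_def wp block_add inner_add_right)
  qed
  have "(q has_derivative (\<lambda>h. ?g \<bullet> h + ?v \<bullet> (cmat P *v block P i h) + 1 / 2 * (w ?p \<bullet> (H i *v h) + h \<bullet> (H i *v w ?p)))) (at ?p)"
    unfolding q_def
    by (intro has_derivative_add has_derivative_mult_right has_derivative_inner has_derivative_inner_right dw dHw dpen)
  then have "GDERIV q ?p :> G" unfolding rhs gderiv_def .
  moreover have "G \<in> ?E"
    unfolding G_def by (intro subspace_add subspace_block_space block_in_block_space block_H i)
  moreover obtain e C where "e > 0" "C-lipschitz_on (cball ?p e \<inter> ?E) (reg P i)"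
    using block_assms(2)[OF i block_in_block_space] by blast
  moreover have "feasible_block P i \<subseteq> mfd P i" by (simp add: feasible_block_def)
  moreover have "feasible_block P i \<subseteq> ?E" using block_assms(3)[OF i] by (auto simp: feasible_block_def)
  ultimately show ?thesis
    using minimizer_mfd_stationary[OF ch _ feasible[OF i] subspace_block_space _ block_assms(1)[OF i]] min by blast
qed

text \<open>The true stationarity vector differs from the one of the subproblem in three ways,
  matching the summands of \<open>\<kappa>3\<close>: the gradient is taken at another point, the new
  multiplier contains the final residual, and the proximal term is absent. Projection onto the
  tangent space is nonexpansive, so the error survives it unenlarged.\<close>

lemma block_stationary:
  assumes i: "i \<in> {1..<N}" and ch: "chart_at (mfd P i) (block P i (x (Suc k))) F U \<psi>"
    and s: "\<And>j. j \<in> {1..N} \<Longrightarrow> (spectral_norm (col_block P j))\<^sup>2 \<le> s"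
    and h: "spectral_norm (H i) \<le> h"
  shows "set_dist
      (closest_point (tangent_space (mfd P i) (block P i (x (Suc k)))) `
        {- partial_grad P i (obj P) (x (Suc k)) + transpose (col_block P i) *v l (Suc k) - g | g.
           g \<in> subdifferential_on (block_space P i) (reg P i) (block P i (x (Suc k)))})
      (mfd_normal_cone (mfd P i) U \<psi> (feasible_block P i) (block P i (x (Suc k))))
    \<le> ereal ((L + \<beta> * sqrt N * s + h) * norm (dx k))"
proof -
  let ?p = "block P i (x (Suc k))" and ?m = "mid i k" and ?m' = "mid (Suc i) k" and ?x = "x (Suc k)"
  let ?T = "tangent_space (mfd P i) ?p" and ?d = "block P i (dx k)"
  define G where "G = block P i (gradf ?m + At (\<beta> *\<^sub>R residual P ?m' - l k)) + H i *v ?d"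
  obtain g where g: "g \<in> subdifferential_on (block_space P i) (reg P i) ?p"
    and n: "closest_point ?T (- G - g) \<in> mfd_normal_cone (mfd P i) U \<psi> (feasible_block P i) ?p"
    using subproblem_stationary[OF i ch] unfolding G_def by blast
  define z where "z = - partial_grad P i (obj P) ?x + transpose (col_block P i) *v l (Suc k) - g"
  have "z - (- G - g) = block P i (gradf ?m - gradf ?x) + \<beta> *\<^sub>R block P i (At (cmat P *v (?m' - ?x))) + H i *v ?d"
  proof -
    have "cmat P *v (?m' - ?x) = residual P ?m' - residual P ?x"
      by (simp add: residual_def matrix_vector_mult_diff_distrib)
    then show ?thesis
      unfolding z_def G_def partial_grad_obj transpose_col_block_mult dual_step
      by (simp add: block_add block_diff block_scaleR matrix_vector_mult_diff_distrib matrix_vector_mult_scaleR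
          scaleR_diff_right)
  qed
  also have "norm \<dots> \<le> L * norm (dx k) + \<beta> * (sqrt N * s * norm (dx k)) + h * norm (dx k)"
  proof (intro order.trans[OF norm_triangle_ineq] add_mono)
    have "norm (block P i (gradf ?m - gradf ?x)) \<le> L * norm (?x - ?m)"
      unfolding norm_minus_commute[of ?x] by (rule order.trans[OF norm_block_le norm_grad_diff_le])
    also have "\<dots> \<le> L * norm (dx k)"
      using L_pos by (intro mult_left_mono norm_diff_mixed_point_le) auto
    finally show "norm (block P i (gradf ?m - gradf ?x)) \<le> L * norm (dx k)" .
    have s0: "0 \<le> s" using N_ge_2 by (intro order.trans[OF zero_le_power2 s[of N]]) simp
    \<comment> \<open>Two factors \<open>sqrt s\<close> arise, one from the transposed block and one
      from the whole constraint matrix; together they give the squared spectral norm.\<close>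
    have s': "spectral_norm (col_block P j) \<le> sqrt s" if "j \<in> {1..N}" for j
      using s[OF that] by (rule real_le_rsqrt)
    have "norm (block P i (At (cmat P *v (?m' - ?x)))) \<le> spectral_norm (col_block P i) * norm (cmat P *v (?m' - ?x))"
      by (rule norm_block_transpose_le)
    also have "\<dots> \<le> sqrt s * (sqrt s * sqrt N * norm (?m' - ?x))"
      using i s0 by (intro mult_mono s' norm_cmat_mult_le) auto
    also have "\<dots> = sqrt N * s * norm (?x - ?m')"
      using s0 by (simp add: norm_minus_commute)
    also have "\<dots> \<le> sqrt N * s * norm (dx k)"
      using s0 by (intro mult_left_mono norm_diff_mixed_point_le) auto
    finally show "norm (\<beta> *\<^sub>R block P i (At (cmat P *v (?m' - ?x)))) \<le> \<beta> * (sqrt N * s * norm (dx k))"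
      using beta_pos by simp
    have "norm (H i *v ?d) \<le> spectral_norm (H i) * norm ?d" by (rule spectral_norm_bound)
    also have "\<dots> \<le> h * norm (dx k)"
      using h spectral_norm_nonneg[of "H i"] by (intro mult_mono norm_block_le) auto
    finally show "norm (H i *v ?d) \<le> h * norm (dx k)" .
  qed
  finally have "norm (z - (- G - g)) \<le> (L + \<beta> * sqrt N * s + h) * norm (dx k)"
    by (simp add: algebra_simps)
  moreover have "norm (closest_point ?T z - closest_point ?T (- G - g)) \<le> norm (z - (- G - g))"
    using subspace_tangent_space[OF ch] unfolding dist_norm[symmetric]
    by (intro closest_point_lipschitz subspace_imp_convex closed_subspace) (auto dest: subspace_0)
  ultimately have "ereal (norm (closest_point ?T z - closest_point ?T (- G - g))) \<le> ereal ((L + \<beta> * sqrt N * s + h) * norm (dx k))"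
    by simp
  with n show ?thesis
    unfolding set_dist_def using g
    by (intro INF_lower2[of "closest_point ?T z"] INF_lower2[of "closest_point ?T (- G - g)"])
      (auto simp: z_def)
qed

text \<open>Only the residual needs both steps in \<open>\<theta>\<close>; the other two measures
  are controlled by the later step alone.\<close>

lemma iterate_eps_stationary:
  fixes k :: nat
  defines "\<theta> \<equiv> (norm (dx (Suc k)))\<^sup>2 + (norm (dx k))\<^sup>2"
  assumes eps: "0 < \<epsilon>"
    and s: "\<And>j. j \<in> {1..N} \<Longrightarrow> (spectral_norm (col_block P j))\<^sup>2 \<le> s"
    and h: "\<And>i. i \<in> {1..<N} \<Longrightarrow> spectral_norm (H i) \<le> h"
    and k1: "3 / \<beta>\<^sup>2 * ((\<beta> - 1 / \<gamma>)\<^sup>2 + L\<^sup>2) * \<theta> \<le> \<epsilon>\<^sup>2"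
    and k2: "(\<bar>\<beta> - 1 / \<gamma>\<bar> + L)\<^sup>2 * \<theta> \<le> \<epsilon>\<^sup>2"
    and k3: "(L + \<beta> * sqrt N * s + h)\<^sup>2 * \<theta> \<le> \<epsilon>\<^sup>2"
  shows "eps_stationary P \<epsilon> (x (Suc (Suc k))) (l (Suc (Suc k)))"
proof -
  have step: "c * norm (dx (Suc k)) \<le> \<epsilon>" if "c\<^sup>2 * \<theta> \<le> \<epsilon>\<^sup>2" for c
  proof (rule power2_le_imp_le)
    have "(c * norm (dx (Suc k)))\<^sup>2 \<le> c\<^sup>2 * \<theta>"
      unfolding power_mult_distrib \<theta>_def by (intro mult_left_mono) auto
    with that show "(c * norm (dx (Suc k)))\<^sup>2 \<le> \<epsilon>\<^sup>2" by simp
  qed (use eps in simp)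
  have "norm (residual P (x (Suc (Suc k)))) \<le> \<epsilon>"
  proof (rule power2_le_imp_le)
    show "(norm (residual P (x (Suc (Suc k)))))\<^sup>2 \<le> \<epsilon>\<^sup>2"
      using norm_residual_le[of k] k1 unfolding \<theta>_def by (rule order.trans)
  qed (use eps in simp)
  moreover have "norm (partial_grad P N (obj P) (x (Suc (Suc k))) - transpose (col_block P N) *v l (Suc (Suc k))) \<le> \<epsilon>"
    using norm_last_gradient_le step[OF k2] by (rule order.trans)
  moreover have "set_dist
      (closest_point (tangent_space (mfd P i) (block P i (x (Suc (Suc k))))) `
        {- partial_grad P i (obj P) (x (Suc (Suc k))) + transpose (col_block P i) *v l (Suc (Suc k)) - g | g.
           g \<in> subdifferential_on (block_space P i) (reg P i) (block P i (x (Suc (Suc k))))})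
      (mfd_normal_cone (mfd P i) U \<psi> (feasible_block P i) (block P i (x (Suc (Suc k)))))
    \<le> ereal \<epsilon>"
    if i: "i \<in> {1..<N}" and ch: "chart_at (mfd P i) (block P i (x (Suc (Suc k)))) F U \<psi>" for i F U \<psi>
    by (rule order.trans[OF block_stationary[OF i ch s h[OF i]]]) (use step[OF k3] in simp_all)
  ultimately show ?thesis
    unfolding eps_stationary_def using feasible by blast
qed

text \<open>Each step belongs to at most two of the \<open>n\<close> candidate sums, so their total
  is at most twice the summed squares. This is the factor 2 in \<open>K\<close>.\<close>

lemma min_step_bound:
  fixes n :: nat and \<tau> \<theta> :: real
  assumes tau: "0 < \<tau>"
    and desc: "\<And>k. potential (Suc k) + \<tau> * (norm (dx (Suc k)))\<^sup>2 \<le> potential k"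
    and min: "\<And>j. j < n \<Longrightarrow> \<theta> \<le> (norm (dx (Suc (Suc j))))\<^sup>2 + (norm (dx (Suc j)))\<^sup>2"
  shows "\<tau> * (n * \<theta>) \<le> 2 * (potential 0 - (\<Sum>i\<in>{1..<N}. reg_min P i) - obj_min P)"
proof -
  define e where "e j = (norm (dx (Suc j)))\<^sup>2" for j
  have e: "0 \<le> e j" for j by (simp add: e_def)
  have "potential (Suc k) \<le> potential k" for k
    using desc[of k] mult_nonneg_nonneg[of \<tau> "e k"] tau e[of k] unfolding e_def by linarith
  then have lower: "(\<Sum>i\<in>{1..<N}. reg_min P i) + obj_min P \<le> potential j" for j
    by (rule potential_lower_bound)
  have tele: "\<tau> * (\<Sum>j<m. e j) \<le> potential 0 - potential m" for m
  proof (induction m)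
    case (Suc m)
    then show ?case using desc[of m] by (simp add: e_def distrib_left)
  qed simp
  have "n * \<theta> = (\<Sum>j<n. \<theta>)" by simp
  also have "\<dots> \<le> (\<Sum>j<n. e (Suc j) + e j)"
    by (intro sum_mono) (simp add: e_def min)
  also have "\<dots> = (\<Sum>j<n. e (Suc j)) + (\<Sum>j<n. e j)" by (rule sum.distrib)
  also have "\<dots> \<le> 2 * (\<Sum>j<Suc n. e j)"
    using sum.lessThan_Suc_shift[of e n] sum.lessThan_Suc[of e n] e[of 0] e[of n] by linarith
  finally have "\<tau> * (n * \<theta>) \<le> \<tau> * (2 * (\<Sum>j<Suc n. e j))"
    using tau by (intro mult_left_mono) auto
  also have "\<dots> = 2 * (\<tau> * (\<Sum>j<Suc n. e j))"
    by (rule mult.left_commute)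
  also have "\<dots> \<le> 2 * (potential 0 - potential (Suc n))"
    by (intro mult_left_mono tele) simp
  also have "\<dots> \<le> 2 * (potential 0 - (\<Sum>i\<in>{1..<N}. reg_min P i) - obj_min P)"
    using lower[of "Suc n"] by simp
  finally show ?thesis .
qed

end

text \<open>The bounds on \<open>1 / \<gamma>\<close> are the roots of a quadratic polynomial whose discriminant is
  positive by the condition on \<open>\<beta>\<close>.\<close>

lemma last_block_descent_coefficient_neg:
  fixes L \<beta> \<gamma> :: real
  assumes L: "0 < L" and beta: "\<beta> > (6 + 18 * sqrt 3) / 13 * L" and gamma0: "0 < \<gamma>"
    and gamma: "\<gamma> \<in> {12 / (13 * \<beta> + sqrt (13 * \<beta>\<^sup>2 - 12 * \<beta> * L - 72 * L\<^sup>2)) <..<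
                      12 / (13 * \<beta> - sqrt (13 * \<beta>\<^sup>2 - 12 * \<beta> * L - 72 * L\<^sup>2))}"
  shows "(\<beta> + L) / 2 - 1 / \<gamma> + 6 / \<beta> * (\<beta> - 1 / \<gamma>)\<^sup>2 + 3 * L\<^sup>2 / \<beta> < 0"
proof -
  define D s t where "D = 13 * \<beta>\<^sup>2 - 12 * \<beta> * L - 72 * L\<^sup>2" and "s = sqrt D" and "t = 1 / \<gamma>"
  have "0 < (6 + 18 * sqrt 3) / 13 * L" using L by (intro mult_pos_pos) (auto simp: add_pos_pos)
  with beta have \<beta>: "0 < \<beta>" by linarith
  \<comment> \<open>Completing the square gives 13 D = (13 \<beta> - 6 L)^2 - 972 L^2 with 972 = (18
    sqrt 3)^2, the origin of the constant in the condition on \<open>\<beta>\<close>.\<close>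
  have "18 * sqrt 3 * L \<le> 13 * \<beta> - 6 * L" using beta by (simp add: field_simps)
  then have "(18 * sqrt 3 * L)\<^sup>2 \<le> (13 * \<beta> - 6 * L)\<^sup>2"
    using L by (intro power_mono) auto
  then have "0 \<le> 13 * D"
    by (simp add: D_def power_mult_distrib power2_diff)
  then have s: "0 \<le> s" "s\<^sup>2 = D" by (simp_all add: s_def)
  \<comment> \<open>Makes the denominator of the upper bound on \<open>\<gamma>\<close> positive, so
    that both bounds can be inverted.\<close>
  have "s\<^sup>2 < (13 * \<beta>)\<^sup>2"
  proof -
    have "0 < 156 * \<beta>\<^sup>2" "0 < 12 * \<beta> * L" "0 < 72 * L\<^sup>2" using \<beta> L by auto
    moreover have "(13 * \<beta>)\<^sup>2 = 169 * \<beta>\<^sup>2" by (simp add: power_mult_distrib)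
    ultimately show ?thesis unfolding s(2) D_def by linarith
  qed
  then have s13: "s < 13 * \<beta>" by (rule power2_less_imp_less) (use \<beta> in simp)
  have g: "12 / (13 * \<beta> + s) < \<gamma>" "\<gamma> < 12 / (13 * \<beta> - s)"
    using gamma by (auto simp: s_def D_def)
  have "12 < \<gamma> * (13 * \<beta> + s)" "\<gamma> * (13 * \<beta> - s) < 12"
    using g s13 s(1) \<beta> by (simp_all add: pos_divide_less_eq pos_less_divide_eq)
  then have "12 * t < 13 * \<beta> + s" "13 * \<beta> - s < 12 * t"
    using gamma0 by (simp_all add: t_def field_simps)
  then have "\<bar>12 * t - 13 * \<beta>\<bar> < \<bar>s\<bar>" using s(1) by linarith
  then have "(12 * t - 13 * \<beta>)\<^sup>2 < s\<^sup>2" using abs_le_square_iff[of s "12 * t - 13 * \<beta>"] by linarith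
  \<comment> \<open>The left side is exactly
    \<open>(12 * t - 13 * \<beta>)\<^sup>2 - s\<^sup>2\<close>; dividing it by 24 \<beta> gives the
    coefficient in question.\<close>
  then have "12 * (12 * t\<^sup>2 - 26 * \<beta> * t + 13 * \<beta>\<^sup>2 + \<beta> * L + 6 * L\<^sup>2) < 0"
    unfolding s(2) D_def by (simp add: power2_diff power_mult_distrib algebra_simps)
  then have "(12 * t\<^sup>2 - 26 * \<beta> * t + 13 * \<beta>\<^sup>2 + \<beta> * L + 6 * L\<^sup>2) / (2 * \<beta>) < 0"
    using \<beta> by (simp add: divide_neg_pos)
  also have "(12 * t\<^sup>2 - 26 * \<beta> * t + 13 * \<beta>\<^sup>2 + \<beta> * L + 6 * L\<^sup>2) / (2 * \<beta>) =
      (\<beta> + L) / 2 - t + 6 / \<beta> * (\<beta> - t)\<^sup>2 + 3 * L\<^sup>2 / \<beta>"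
    using \<beta> by (simp add: power2_diff field_simps) (simp add: power2_eq_square algebra_simps)
  finally show ?thesis by (simp add: t_def)
qed

theorem theorem3p9:
  fixes P :: "('d::finite, 'm::finite) problem"
    and H :: "nat \<Rightarrow> real^('d + 'm)^('d + 'm)"
    and x :: "nat \<Rightarrow> real^('d + 'm)" and l :: "nat \<Rightarrow> real^'m"
    and L \<beta> \<gamma> \<epsilon> \<kappa>1 \<kappa>2 \<kappa>3 \<tau> :: real and N kstar :: nat and K :: int
  assumes problem: "admissible_problem P L"
    and N: "N = nblocks P"
    and algorithm: "algorithm2 P \<beta> \<gamma> H x l"
    and beta: "\<beta> > (6 + 18 * sqrt 3) / 13 * L"
    and gamma: "\<gamma> \<in> {12 / (13 * \<beta> + sqrt (13 * \<beta>\<^sup>2 - 12 * \<beta> * L - 72 * L\<^sup>2)) <..<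
                      12 / (13 * \<beta> - sqrt (13 * \<beta>\<^sup>2 - 12 * \<beta> * L - 72 * L\<^sup>2))}"
    and H: "\<And>i. i \<in> {1..N-1} \<Longrightarrow> pos_def_on (block_space P i) (H i - (6 * L\<^sup>2 / \<beta> + L) *\<^sub>R mat 1)"
    and kappa1: "\<kappa>1 = 3 / \<beta>\<^sup>2 * ((\<beta> - 1 / \<gamma>)\<^sup>2 + L\<^sup>2)"
    and kappa2: "\<kappa>2 = (\<bar>\<beta> - 1 / \<gamma>\<bar> + L)\<^sup>2"
    and kappa3: "\<kappa>3 = (L + \<beta> * sqrt (real N) * Max ((\<lambda>i. (spectral_norm (col_block P i))\<^sup>2) ` {1..N})
                       + Max ((\<lambda>i. spectral_norm (H i)) ` {1..N-1}))\<^sup>2"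
    and tau: "\<tau> = min (- ((\<beta> + L) / 2 - 1 / \<gamma> + 6 / \<beta> * (\<beta> - 1 / \<gamma>)\<^sup>2 + 3 * L\<^sup>2 / \<beta>))
                      (Min ((\<lambda>i. - (3 * L\<^sup>2 / \<beta> + L / 2 - sigma_min_on (block_space P i) (H i) / 2)) ` {1..N-1}))"
    and eps: "\<epsilon> > 0"
    and K: "K = \<lceil>2 * Max {\<kappa>1, \<kappa>2, \<kappa>3} / (\<tau> * \<epsilon>\<^sup>2) *
                 (Psi_G P L \<beta> \<gamma> (x 1) (l 1) (block P N (x 0)) - (\<Sum>i=1..N-1. reg_min P i) - obj_min P)\<rceil>"
    and kstar: "is_arg_min
                  (\<lambda>k. \<Sum>i=1..N. (norm (block P i (x k) - block P i (x (k + 1))))\<^sup>2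
                                 + (norm (block P i (x (k - 1)) - block P i (x k)))\<^sup>2)
                  (\<lambda>k. 2 \<le> k \<and> int k \<le> K + 1) kstar"
  shows "eps_stationary P \<epsilon> (x (kstar + 1)) (l (kstar + 1))"
proof -
  interpret A: prox_grad_admm P L \<beta> \<gamma> H x l
    using problem algorithm by unfold_locales
  have N2: "2 \<le> N" unfolding N by (rule A.N_ge_2)
  have L: "0 < L" by (rule A.L_pos)
  have \<beta>: "0 < \<beta>" by (rule A.beta_pos)
  have idx: "{1..N-1} = {1..<N}" using N2 by auto
  let ?t1 = "- ((\<beta> + L) / 2 - 1 / \<gamma> + 6 / \<beta> * (\<beta> - 1 / \<gamma>)\<^sup>2 + 3 * L\<^sup>2 / \<beta>)"
  let ?t2 = "\<lambda>i. - (3 * L\<^sup>2 / \<beta> + L / 2 - sigma_min_on (block_space P i) (H i) / 2)"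
  have ne: "{1..<N} \<noteq> {}" using N2 by simp
  have t1: "\<tau> \<le> ?t1" unfolding tau by (rule min.cobounded1)
  have t2: "\<tau> \<le> ?t2 i" if "i \<in> {1..<nblocks P}" for i
  proof -
    have "Min (?t2 ` {1..<N}) \<le> ?t2 i" using that by (intro Min_le) (auto simp: N)
    then show ?thesis unfolding tau idx by (rule min.coboundedI2)
  qed
  have "0 < \<tau>"
  proof -
    have "0 < ?t1"
      using last_block_descent_coefficient_neg[OF L beta A.gamma_pos gamma] by simp
    moreover have "0 < ?t2 i" if i: "i \<in> {1..<N}" for i
    proof -
      have i': "i \<in> {1..<nblocks P}" using i by (simp add: N)
      have "6 * L\<^sup>2 / \<beta> + L < sigma_min_on (block_space P i) (H i)"
      proof (rule A.sigma_bounds(2)[OF i' i' i' i'])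
        show "pos_def_on (block_space P i) (H i - (6 * L\<^sup>2 / \<beta> + L) *\<^sub>R mat 1)"
          using i unfolding idx[symmetric] by (rule H)
      qed (use L \<beta> in simp)
      then show ?thesis by simp
    qed
    then have "0 < Min (?t2 ` {1..<N})" using ne by (subst Min_gr_iff) auto
    ultimately show ?thesis unfolding tau idx by simp
  qed
  have desc: "A.potential (Suc k) + \<tau> * (norm (x (Suc (Suc k)) - x (Suc k)))\<^sup>2 \<le> A.potential k" for k
    by (rule A.potential_descent[OF t1 t2])
  define \<kappa> where "\<kappa> = Max {\<kappa>1, \<kappa>2, \<kappa>3}"
  define e where "e k = (norm (x (Suc k) - x k))\<^sup>2" for k
  define \<Delta> where "\<Delta> = A.potential 0 - (\<Sum>i\<in>{1..<N}. reg_min P i) - obj_min P"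
  have K': "K = \<lceil>2 * \<kappa> / (\<tau> * \<epsilon>\<^sup>2) * \<Delta>\<rceil>"
    unfolding K \<kappa>_def \<Delta>_def A.potential_def idx by (simp add: N)
  \<comment> \<open>The restriction to \<open>1 \<le> k\<close> matters because \<open>k - 1\<close>
    is truncated subtraction. Summed over the blocks, the criterion consists of two full squared
    steps.\<close>
  have obj_eq: "(\<Sum>i=1..N. (norm (block P i (x k) - block P i (x (k + 1))))\<^sup>2
      + (norm (block P i (x (k - 1)) - block P i (x k)))\<^sup>2) = e k + e (k - 1)" if "1 \<le> k" for k
  proof -
    have k: "Suc (k - 1) = k" using that by simp
    have "(\<Sum>i=1..N. (norm (block P i (x j) - block P i (x (Suc j))))\<^sup>2) = e j" for j
      using block_decomposition(1)[OF A.label_range, of "x (Suc j) - x j"]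
      unfolding N e_def by (simp only: block_diff norm_minus_commute)
    from this[of k] this[of "k - 1"] show ?thesis
      unfolding k by (simp only: sum.distrib Suc_eq_plus1)
  qed
  have k2: "2 \<le> kstar" and kK: "int kstar \<le> K + 1"
    using kstar by (auto simp: is_arg_min_def)
  have min: "e kstar + e (kstar - 1) \<le> e k + e (k - 1)" if "2 \<le> k" "int k \<le> K + 1" for k
    using kstar that k2 obj_eq[of k] obj_eq[of kstar] unfolding is_arg_min_def by force
  obtain j where j: "kstar = Suc (Suc j)" using k2 by (metis add_2_eq_Suc le_Suc_ex)
  define \<theta> where "\<theta> = e (Suc (Suc j)) + e (Suc j)"
  \<comment> \<open>The existence of a minimizer already makes the candidate range nonempty, so the
    integer \<open>K\<close> is positive and equals \<open>nat K\<close>.\<close>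
  have K1: "1 \<le> K" using k2 kK by linarith
  have "\<tau> * (nat K * \<theta>) \<le> 2 * \<Delta>"
    unfolding \<Delta>_def N
  \<comment> \<open>The index \<open>i < nat K\<close> stands for the candidate
    \<open>i + 2\<close>, so the \<open>nat K\<close> sums run exactly over 2, ..., K + 1.\<close>
  proof (rule A.min_step_bound[OF \<open>0 < \<tau>\<close> desc])
    fix i assume "i < nat K"
    then show "\<theta> \<le> (norm (x (Suc (Suc (Suc i))) - x (Suc (Suc i))))\<^sup>2 + (norm (x (Suc (Suc i)) - x (Suc i)))\<^sup>2"
      using min[of "Suc (Suc i)"] by (simp add: j \<theta>_def e_def)
  qed
  then have 1: "\<tau> * (K * \<theta>) \<le> 2 * \<Delta>" using K1 by simp
  have \<kappa>: "\<kappa>1 \<le> \<kappa>" "\<kappa>2 \<le> \<kappa>" "\<kappa>3 \<le> \<kappa>" unfolding \<kappa>_def by (intro Max_ge; simp)+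
  have \<kappa>0: "0 \<le> \<kappa>" using \<kappa>(2) unfolding kappa2 by (rule order.trans[OF zero_le_power2])
  have "2 * \<kappa> / (\<tau> * \<epsilon>\<^sup>2) * \<Delta> \<le> K" unfolding K' by (rule le_of_int_ceiling)
  then have "\<kappa> * (2 * \<Delta>) \<le> K * (\<tau> * \<epsilon>\<^sup>2)"
    using \<open>0 < \<tau>\<close> eps by (simp add: field_simps)
  moreover have "\<kappa> * (\<tau> * (K * \<theta>)) \<le> \<kappa> * (2 * \<Delta>)" using 1 \<kappa>0 by (rule mult_left_mono)
  ultimately have "(K * \<tau>) * (\<kappa> * \<theta>) \<le> (K * \<tau>) * \<epsilon>\<^sup>2" by (simp add: mult_ac)
  moreover have "0 < K * \<tau>" using K1 \<open>0 < \<tau>\<close> by simp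
  ultimately have \<kappa>\<theta>: "\<kappa> * \<theta> \<le> \<epsilon>\<^sup>2" by (rule mult_left_le_imp_le)
  have "0 \<le> \<theta>" by (simp add: \<theta>_def e_def)
  have le: "c * \<theta> \<le> \<epsilon>\<^sup>2" if "c \<le> \<kappa>" for c
    using mult_right_mono[OF that \<open>0 \<le> \<theta>\<close>] \<kappa>\<theta> by (rule order.trans)
  have "eps_stationary P \<epsilon> (x (Suc (Suc (Suc j)))) (l (Suc (Suc (Suc j))))"
  proof (rule A.iterate_eps_stationary[OF eps])
    show "(spectral_norm (col_block P i))\<^sup>2 \<le> Max ((\<lambda>i. (spectral_norm (col_block P i))\<^sup>2) ` {1..N})"
      if "i \<in> {1..nblocks P}" for i
      using that by (intro Max_ge) (auto simp: N)
    show "spectral_norm (H i) \<le> Max ((\<lambda>i. spectral_norm (H i)) ` {1..N-1})"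
      if "i \<in> {1..<nblocks P}" for i
      using that unfolding idx by (intro Max_ge) (auto simp: N)
  qed (use \<kappa>[THEN le] in \<open>simp_all only: kappa1 kappa2 kappa3 \<theta>_def e_def N\<close>)
  then show ?thesis by (simp add: j)
qed

end
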